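(* Let $E$ be a Banach space. Let $T=\{T_t\}_{t\in\mathbb{R}^+}$ be a weakly continuous semigroup on $UC_b(E)$. Then $T$ is a $C_0$-sequentially locally equicontinuous semigroup on $(UC_b(E),\tau_{\mathcal{K}})$ and, for every $\lambda>\alpha$ (where $\alpha\in\mathbb{R}$ is such that, for some $M\ge1$, $|T_tf|_\infty\le Me^{\alpha t}|f|_\infty$ for all $t\in\mathbb{R}^+$ and $f\in UC_b(E)$), $\{e^{-\lambda t}T_t\}_{t\in\mathbb{R}^+}$ is a $C_0$-sequentially equicontinuous semigroup on $(UC_b(E),\tau_{\mathcal{K}})$ such that, for every $f\in UC_b(E)$ and $\mu>0$, the generalized Riemann integral $\int_0^{+\infty}e^{-\mu t}e^{-\lambda t}T_tf\,dt$ exists in $(UC_b(E),\tau_{\mathcal{K}})$. Conversely, if $T$ is a $C_0$-sequentially locally equicontinuous semigroup on $(UC_b(E),\tau_{\mathcal{K}})$ such that for every $f\in UC_b(E)$ and every $\hat t>0$ there is a modulus of continuity $w$ with $\sup_{t\in[0,\hat t]}|T_tf(\xi)-T_tf(\xi')|\le w(|\xi-\xi'|_E)$ for all $\xi,\xi'\in E$, then $T$ is a weakly continuous semigroup on $UC_b(E)$.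
   Context: $\mathbb{R}^+=[0,+\infty)$; $UC_b(E)$ is the space of bounded uniformly continuous real-valued functions on $E$ with sup-norm $|\cdot|_\infty$; $[f]_K=\sup_{x\in K}|f(x)|$. $\mathbf{ca}(E)$ is the space of countably additive finite signed Borel measures on $E$. $\tau_{\mathcal{K}}$ is the locally convex topology on $UC_b(E)$ generated by the seminorms $p_{K,\mu}(f)=[f]_K+\left|\int_Ef\,d\mu\right|$, with $K$ ranging over the non-empty compact subsets of $E$ and $\mu$ over $\mathbf{ca}(E)$. A net $\{f_\iota\}\subset UC_b(E)$ is $\mathcal{K}$-convergent to $f\in UC_b(E)$, written $f_\iota\stackrel{\mathcal{K}}{\longrightarrow}f$, if $\sup_\iota|f_\iota|_\infty<+\infty$ and $\lim_\iota[f_\iota-f]_K=0$ for every non-empty compact $K\subset E$. A weakly continuous semigroup on $UC_b(E)$ is a family $T=\{T_t\}_{t\in\mathbb{R}^+}$ of bounded linear operators on $(UC_b(E),|\cdot|_\infty)$ such that: (P1) $T_0=I$ and $T_tT_s=T_{t+s}$ for $t,s\in\mathbb{R}^+$; (P2) there exist $M\ge1$ and $\alpha\in\mathbb{R}$ such that $|T_tf|_\infty\le Me^{\alpha t}|f|_\infty$ for all $t\in\mathbb{R}^+$, $f\in UC_b(E)$; (P3) for every $f\in UC_b(E)$ and every $\hat t>0$ there is a modulus of continuity $w$ such that $\sup_{t\in[0,\hat t]}|T_tf(\xi)-T_tf(\xi')|\le w(|\xi-\xi'|_E)$ for all $\xi,\xi'\in E$; (P4) for every $f\in UC_b(E)$,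 $T_tf\stackrel{\mathcal{K}}{\longrightarrow}f$ as $t\to0^+$, i.e. (in view of (P2)) $\lim_{t\to0^+}[T_tf-f]_K=0$ for every non-empty compact $K\subset E$; (P5) if a sequence $f_n\stackrel{\mathcal{K}}{\longrightarrow}f$, then $T_tf_n\stackrel{\mathcal{K}}{\longrightarrow}T_tf$ uniformly in $t\in[0,\hat t]$ for every $\hat t>0$, i.e. (in view of (P2)) $\lim_{n\to+\infty}\sup_{t\in[0,\hat t]}[T_tf_n-T_tf]_K=0$ for every non-empty compact $K\subset E$. A family $\{f_\iota\}_{\iota\in\mathcal{I}}$ of maps from a topological vector space $Z$ to itself is sequentially equicontinuous if for every $z_n\to z$ in $Z$ and every neighborhood $U$ of $0$ there is $\overline n$ with $f_\iota(z_n)\in f_\iota(z)+U$ for all $\iota\in\mathcal{I}$, $n\ge\overline n$. A family of linear operators $\{T_t\}_{t\in\mathbb{R}^+}$ on a Hausdorff locally convex space $Z$ is a $C_0$-sequentially equicontinuous (resp. $C_0$-sequentially locally equicontinuous) semigroup if $T_0=I$, $T_{t+s}=T_tT_s$, $\lim_{t\to0^+}T_tz=z$ for all $z\in Z$, and $\{T_t\}_{t\in\mathbb{R}^+}$ is sequentially equicontinuous (resp. $\{T_t\}_{t\in[0,R]}$ is sequentially equicontinuous for every $R>0$). The generalized Riemann integral over $[0,+\infty)$ exists if the Riemann integrals over $[0,a]$ exist for all $a\ge0$ and converge as $a\to+\infty$. *)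

theory Defs
  imports "HOL-Analysis.Analysis"
begin

section \<open>The normed space of bounded uniformly continuous real functions\<close>

typedef (overloaded) 'a ucb =
  "{f :: 'a::metric_space \<Rightarrow>\<^sub>C real. uniformly_continuous_on UNIV (apply_bcontfun f)}"
  morphisms bcontfun_of_ucb Ucb
proof
  show "0 \<in> {f :: 'a \<Rightarrow>\<^sub>C real. uniformly_continuous_on UNIV (apply_bcontfun f)}"
    by (simp add: uniformly_continuous_on_const)
qed

setup_lifting type_definition_ucb

definition apply_ucb :: "'a::metric_space ucb \<Rightarrow> 'a \<Rightarrow> real" where
  "apply_ucb f = apply_bcontfun (bcontfun_of_ucb f)"

instantiation ucb :: (metric_space) real_vector
begin

lift_definition zero_ucb :: "'a ucb" is 0
  by (simp add: uniformly_continuous_on_const)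

lift_definition plus_ucb :: "'a ucb \<Rightarrow> 'a ucb \<Rightarrow> 'a ucb" is "(+)"
  by (simp add: uniformly_continuous_on_add)

lift_definition minus_ucb :: "'a ucb \<Rightarrow> 'a ucb \<Rightarrow> 'a ucb" is "(-)"
  by (simp add: uniformly_continuous_on_diff)

lift_definition uminus_ucb :: "'a ucb \<Rightarrow> 'a ucb" is uminus
  by (simp add: uniformly_continuous_on_minus)

lift_definition scaleR_ucb :: "real \<Rightarrow> 'a ucb \<Rightarrow> 'a ucb" is "(*\<^sub>R)"
  using uniformly_continuous_on_cmul by fastforce

instance
proof
  fix f g h :: "'a ucb" and a b :: real
  show "f + g + h = f + (g + h)" by transfer (simp add: add.assoc)
  show "f + g = g + f" by transfer (simp add: add.commute)
  show "0 + f = f" by transfer simp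
  show "- f + f = 0" by transfer simp
  show "f - g = f + - g" by transfer simp
  show "a *\<^sub>R (f + g) = a *\<^sub>R f + a *\<^sub>R g" by transfer (simp add: scaleR_add_right)
  show "(a + b) *\<^sub>R f = a *\<^sub>R f + b *\<^sub>R f" by transfer (simp add: scaleR_add_left)
  show "a *\<^sub>R b *\<^sub>R f = (a * b) *\<^sub>R f" by transfer simp
  show "1 *\<^sub>R f = f" by transfer simp
qed

end

instantiation ucb :: (metric_space) real_normed_vector
begin

lift_definition norm_ucb :: "'a ucb \<Rightarrow> real" is norm .

lift_definition dist_ucb :: "'a ucb \<Rightarrow> 'a ucb \<Rightarrow> real" is dist .

definition "sgn (f :: 'a ucb) = f /\<^sub>R norm f"

definition uniformity_ucb :: "('a ucb \<times> 'a ucb) filter" where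
  "uniformity_ucb = (INF e\<in>{0<..}. principal {(x, y). dist x y < e})"

definition open_ucb :: "'a ucb set \<Rightarrow> bool" where
  "open_ucb S = (\<forall>x\<in>S. \<forall>\<^sub>F (x', y) in uniformity. x' = x \<longrightarrow> y \<in> S)"

instance
proof
  fix f g :: "'a ucb" and a :: real
  show "dist f g = norm (f - g)" by transfer (simp add: dist_norm)
  show "norm f = 0 \<longleftrightarrow> f = 0" by transfer simp
  show "norm (f + g) \<le> norm f + norm g" by transfer (rule norm_triangle_ineq)
  show "norm (a *\<^sub>R f) = \<bar>a\<bar> * norm f" by transfer simp
qed (rule sgn_ucb_def uniformity_ucb_def open_ucb_def)+

end

lemma apply_ucb_simps [simp]:
  "apply_ucb 0 x = 0"
  "apply_ucb (f + g) x = apply_ucb f x + apply_ucb g x"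
  "apply_ucb (f - g) x = apply_ucb f x - apply_ucb g x"
  "apply_ucb (- f) x = - apply_ucb f x"
  "apply_ucb (a *\<^sub>R f) x = a * apply_ucb f x"
  by (simp_all add: apply_ucb_def zero_ucb.rep_eq plus_ucb.rep_eq minus_ucb.rep_eq
      uminus_ucb.rep_eq scaleR_ucb.rep_eq)

lemma range_apply_ucb:
  "range apply_ucb =
    {f :: 'a::metric_space \<Rightarrow> real. bounded (range f) \<and> uniformly_continuous_on UNIV f}"
proof (intro equalityI subsetI)
  fix f :: "'a \<Rightarrow> real"
  assume "f \<in> range apply_ucb"
  then show "f \<in> {f. bounded (range f) \<and> uniformly_continuous_on UNIV f}"
    using bcontfun_of_ucb by (auto simp: apply_ucb_def)
next
  fix f :: "'a \<Rightarrow> real"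
  assume f: "f \<in> {f. bounded (range f) \<and> uniformly_continuous_on UNIV f}"
  then have "f \<in> bcontfun"
    by (auto simp: bcontfun_def intro: uniformly_continuous_imp_continuous)
  then have *: "apply_bcontfun (Bcontfun f) = f"
    by (rule Bcontfun_inverse)
  with f have "apply_ucb (Ucb (Bcontfun f)) = f"
    by (simp add: apply_ucb_def Ucb_inverse)
  then show "f \<in> range apply_ucb"
    by (metis rangeI)
qed

lemma norm_ucb_eq_SUP: "norm f = (SUP x. \<bar>apply_ucb f x\<bar>)"
  by (simp add: norm_ucb.rep_eq norm_bcontfun_def dist_bcontfun.rep_eq dist_real_def apply_ucb_def)


section \<open>Locally convex topologies and semigroups of operators\<close>

text \<open>
  The spaces below carry a topology other than the one of their type class, so a topological
  vector space is a type of class \<^class>\<open>real_vector\<close> together with a topology \<open>\<tau>\<close> on it.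
\<close>

definition hausdorff_locally_convex :: "'z::real_vector topology \<Rightarrow> bool" where
  "hausdorff_locally_convex \<tau> \<longleftrightarrow>
     topspace \<tau> = UNIV \<and> Hausdorff_space \<tau> \<and>
     continuous_map (prod_topology \<tau> \<tau>) \<tau> (\<lambda>(x, y). x + y) \<and>
     continuous_map (prod_topology euclideanreal \<tau>) \<tau> (\<lambda>(c, x). c *\<^sub>R x) \<and>
     (\<forall>U. openin \<tau> U \<and> 0 \<in> U \<longrightarrow> (\<exists>V. openin \<tau> V \<and> convex V \<and> 0 \<in> V \<and> V \<subseteq> U))"

definition seminorm_topology :: "('z::real_vector \<Rightarrow> real) set \<Rightarrow> 'z topology" where
  "seminorm_topology P =
     topology_generated_by {{y. p (y - x) < e} | p x e. p \<in> P \<and> 0 < e}"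

definition seq_equicontinuous ::
    "'z::real_vector topology \<Rightarrow> 'i set \<Rightarrow> ('i \<Rightarrow> 'z \<Rightarrow> 'z) \<Rightarrow> bool" where
  "seq_equicontinuous \<tau> I f \<longleftrightarrow>
     (\<forall>zs z. limitin \<tau> zs z sequentially \<longrightarrow>
        (\<forall>U. openin \<tau> U \<and> 0 \<in> U \<longrightarrow>
           (\<exists>N. \<forall>i\<in>I. \<forall>n\<ge>N. f i (zs n) \<in> (\<lambda>u. f i z + u) ` U)))"

text \<open>Semigroups are indexed by \<^typ>\<open>real\<close>; only the values at \<open>t \<ge> 0\<close> are relevant.\<close>

definition semigroup_law :: "(real \<Rightarrow> 'z \<Rightarrow> 'z) \<Rightarrow> bool" where
  "semigroup_law T \<longleftrightarrow> T 0 = id \<and> (\<forall>t\<ge>0. \<forall>s\<ge>0. T (t + s) = T t \<circ> T s)"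

definition C0_semigroup :: "'z::real_vector topology \<Rightarrow> (real \<Rightarrow> 'z \<Rightarrow> 'z) \<Rightarrow> bool" where
  "C0_semigroup \<tau> T \<longleftrightarrow>
     hausdorff_locally_convex \<tau> \<and> (\<forall>t\<ge>0. linear (T t)) \<and> semigroup_law T \<and>
     (\<forall>z. limitin \<tau> (\<lambda>t. T t z) z (at_right 0))"

definition C0_seq_equicontinuous_semigroup ::
    "'z::real_vector topology \<Rightarrow> (real \<Rightarrow> 'z \<Rightarrow> 'z) \<Rightarrow> bool" where
  "C0_seq_equicontinuous_semigroup \<tau> T \<longleftrightarrow>
     C0_semigroup \<tau> T \<and> seq_equicontinuous \<tau> {0..} T"

definition C0_seq_locally_equicontinuous_semigroup ::
    "'z::real_vector topology \<Rightarrow> (real \<Rightarrow> 'z \<Rightarrow> 'z) \<Rightarrow> bool" where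
  "C0_seq_locally_equicontinuous_semigroup \<tau> T \<longleftrightarrow>
     C0_semigroup \<tau> T \<and> (\<forall>R>0. seq_equicontinuous \<tau> {0..R} T)"


section \<open>Riemann integrals with values in a topological vector space\<close>

text \<open>
  For a cell \<open>k\<close>, which is a compact interval, \<open>measure lborel k\<close> is its length, so the bound on the
  cells is a bound on the mesh of the tagged division.
\<close>

definition has_riemann_integral ::
    "'z::real_vector topology \<Rightarrow> (real \<Rightarrow> 'z) \<Rightarrow> real \<Rightarrow> real \<Rightarrow> 'z \<Rightarrow> bool" where
  "has_riemann_integral \<tau> g a b J \<longleftrightarrow>
     (\<forall>U. openin \<tau> U \<and> J \<in> U \<longrightarrow>
        (\<exists>\<delta>>0. \<forall>p. p tagged_division_of {a..b} \<and> (\<forall>(x, k)\<in>p. measure lborel k < \<delta>) \<longrightarrow>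
           (\<Sum>(x, k)\<in>p. measure lborel k *\<^sub>R g x) \<in> U))"

definition generalized_riemann_integrable ::
    "'z::real_vector topology \<Rightarrow> (real \<Rightarrow> 'z) \<Rightarrow> bool" where
  "generalized_riemann_integrable \<tau> g \<longleftrightarrow>
     (\<exists>J L. (\<forall>a\<ge>0. has_riemann_integral \<tau> g 0 a (J a)) \<and> limitin \<tau> J L at_top)"


section \<open>Finite signed Borel measures\<close>

definition ca :: "('a::topological_space set \<Rightarrow> real) set" where
  "ca = {\<mu>. \<forall>A. range A \<subseteq> sets borel \<and> disjoint_family A \<longrightarrow>
             (\<lambda>n::nat. \<mu> (A n)) sums \<mu> (\<Union>n. A n)}"

text \<open>
  The upper variation in the Jordan decomposition.  Since \<^const>\<open>ennreal\<close> truncates negative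
  numbers to \<open>0\<close> and the empty set is among the sets \<open>B\<close>, the truncation does not change the
  supremum.  The lower variation is the upper variation of \<open>- \<mu>\<close>.
\<close>

definition upper_variation :: "('a::topological_space set \<Rightarrow> real) \<Rightarrow> 'a measure" where
  "upper_variation \<mu> =
     measure_of UNIV (sets borel) (\<lambda>A. SUP B\<in>{B \<in> sets borel. B \<subseteq> A}. ennreal (\<mu> B))"

definition signed_integral ::
    "('a::topological_space set \<Rightarrow> real) \<Rightarrow> ('a \<Rightarrow> real) \<Rightarrow> real" where
  "signed_integral \<mu> f =
     (\<integral>x. f x \<partial>upper_variation \<mu>) - (\<integral>x. f x \<partial>upper_variation (\<lambda>A. - \<mu> A))"


section \<open>The topology \<open>\<tau>\<^sub>\<K>\<close> and weakly continuous semigroups\<close>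

definition sup_on :: "'a::metric_space set \<Rightarrow> 'a ucb \<Rightarrow> real" where
  "sup_on K f = (SUP x\<in>K. \<bar>apply_ucb f x\<bar>)"

definition tauK_seminorm ::
    "'a::metric_space set \<Rightarrow> ('a set \<Rightarrow> real) \<Rightarrow> 'a ucb \<Rightarrow> real" where
  "tauK_seminorm K \<mu> f = sup_on K f + \<bar>signed_integral \<mu> (apply_ucb f)\<bar>"

definition tauK :: "'a::metric_space ucb topology" where
  "tauK = seminorm_topology {tauK_seminorm K \<mu> | K \<mu>. compact K \<and> K \<noteq> {} \<and> \<mu> \<in> ca}"

definition K_convergent :: "(nat \<Rightarrow> 'a::metric_space ucb) \<Rightarrow> 'a ucb \<Rightarrow> bool" where
  "K_convergent fs f \<longleftrightarrow>
     bdd_above (range (\<lambda>n. norm (fs n))) \<and>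
     (\<forall>K. compact K \<and> K \<noteq> {} \<longrightarrow> (\<lambda>n. sup_on K (fs n - f)) \<longlonglongrightarrow> 0)"

definition modulus_of_continuity :: "(real \<Rightarrow> real) \<Rightarrow> bool" where
  "modulus_of_continuity w \<longleftrightarrow> mono_on {0..} w \<and> w 0 = 0 \<and> (w \<longlongrightarrow> 0) (at_right 0)"

definition locally_equi_uniformly_continuous ::
    "(real \<Rightarrow> 'a::metric_space ucb \<Rightarrow> 'a ucb) \<Rightarrow> bool" where
  "locally_equi_uniformly_continuous T \<longleftrightarrow>
     (\<forall>f. \<forall>t'>0. \<exists>w. modulus_of_continuity w \<and>
        (\<forall>\<xi> \<xi>'. \<forall>t\<in>{0..t'}.
           \<bar>apply_ucb (T t f) \<xi> - apply_ucb (T t f) \<xi>'\<bar> \<le> w (dist \<xi> \<xi>')))"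

definition growth_bound ::
    "(real \<Rightarrow> 'z::real_normed_vector \<Rightarrow> 'z) \<Rightarrow> real \<Rightarrow> real \<Rightarrow> bool" where
  "growth_bound T M \<alpha> \<longleftrightarrow> (\<forall>t\<ge>0. \<forall>f. norm (T t f) \<le> M * exp (\<alpha> * t) * norm f)"

text \<open>
  In the last condition the suprema over \<open>t\<close> are suprema of bounded sets because of the growth
  bound.
\<close>

definition weakly_continuous_semigroup ::
    "(real \<Rightarrow> 'a::metric_space ucb \<Rightarrow> 'a ucb) \<Rightarrow> bool" where
  "weakly_continuous_semigroup T \<longleftrightarrow>
     (\<forall>t\<ge>0. bounded_linear (T t)) \<and>
     semigroup_law T \<and>
     (\<exists>M\<ge>1. \<exists>\<alpha>. growth_bound T M \<alpha>) \<and>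
     locally_equi_uniformly_continuous T \<and>
     (\<forall>f K. compact K \<and> K \<noteq> {} \<longrightarrow> ((\<lambda>t. sup_on K (T t f - f)) \<longlongrightarrow> 0) (at_right 0)) \<and>
     (\<forall>fs f. K_convergent fs f \<longrightarrow>
        (\<forall>t'>0. \<forall>K. compact K \<and> K \<noteq> {} \<longrightarrow>
           (\<lambda>n. SUP t\<in>{0..t'}. sup_on K (T t (fs n) - T t f)) \<longlonglongrightarrow> 0))"

end

theory Submission
  imports Defs
begin

text \<open>
  The topology \<open>\<tau>\<^sub>\<K>\<close> is not metrizable in general, but all limits in the proposition can be tested
  along sequences, and for sequences \<open>\<tau>\<^sub>\<K>\<close>-convergence is the same as \<open>\<K>\<close>-convergence, that is,
  norm boundedness together with uniform convergence on compact sets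
  (\<open>limitin_tauK_iff_K_convergent\<close>).  One half of this is dominated convergence.  The other half says
  that convergence of the integrals against all measures forces norm boundedness; it is a gliding
  hump argument with discrete measures (\<open>norm_bounded_if_signed_integrals_tend_to_zero\<close>).

  Sequential equicontinuity of a family means that \<open>f\<^sub>i z\<^sub>n - f\<^sub>i z\<close> tends to \<open>0\<close> along every selection of
  indices \<open>i = i\<^sub>n\<close> (\<open>seq_equicontinuous_iff_selections\<close>).  In this form it is a statement on sequences,
  so \<open>\<tau>\<^sub>\<K>\<close> may be replaced by \<open>\<K>\<close>-convergence, and local sequential equicontinuity becomes the last
  axiom of a weakly continuous semigroup.

  The semigroup \<open>e\<^sup>-\<^sup>\<lambda>\<^sup>t T t\<close> is again weakly continuous, with exponent \<open>\<alpha> - \<lambda>\<close>.  If the exponent is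
  negative, large times contribute little in norm, so that equicontinuity on compact time intervals
  extends to all times, and the integrals of orbits over \<open>[0, a]\<close> converge in norm as \<open>a \<rightarrow> \<infinity>\<close>.  The
  integral over \<open>[0, a]\<close> exists because orbits are uniformly continuous in time, uniformly on each
  compact set of points, and equicontinuous in space; a sequence of Riemann sums with mesh tending
  to \<open>0\<close> is therefore \<open>\<K>\<close>-convergent to the pointwise integral.

  For the converse, what has to be shown is the growth bound.  If the operators were not uniformly
  bounded on \<open>[0, 1]\<close>, a norm null sequence would have images, along a selection of times, that are
  unbounded in norm and nevertheless \<open>\<tau>\<^sub>\<K>\<close>-convergent.  The semigroup law turns a bound on \<open>[0, 1]\<close> into
  an exponential one.
\<close>

section \<open>Topologies generated by seminorms\<close>

definition seminorm :: "('z::real_vector \<Rightarrow> real) \<Rightarrow> bool" where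
  "seminorm p \<longleftrightarrow> (\<forall>x y. p (x + y) \<le> p x + p y) \<and> (\<forall>c x. p (c *\<^sub>R x) = \<bar>c\<bar> * p x)"

lemma seminorm_triangle: "seminorm p \<Longrightarrow> p (x + y) \<le> p x + p y"
  by (simp add: seminorm_def)

lemma seminorm_scaleR: "seminorm p \<Longrightarrow> p (c *\<^sub>R x) = \<bar>c\<bar> * p x"
  by (simp add: seminorm_def)

lemma seminorm_zero: "seminorm p \<Longrightarrow> p 0 = 0"
  using seminorm_scaleR[of p 0 0] by simp

lemma seminorm_minus: "seminorm p \<Longrightarrow> p (- x) = p x"
  using seminorm_scaleR[of p "-1" x] by simp

lemma seminorm_nonneg: "seminorm p \<Longrightarrow> 0 \<le> p x"
  using seminorm_triangle[of p x "- x"] by (simp add: seminorm_minus seminorm_zero)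

lemma seminorm_diff_triangle: "seminorm p \<Longrightarrow> p (x - z) \<le> p (x - y) + p (y - z)"
  using seminorm_triangle[of p "x - y" "y - z"] by simp

lemma openin_seminorm_ball:
  "p \<in> P \<Longrightarrow> 0 < e \<Longrightarrow> openin (seminorm_topology P) {y. p (y - x) < e}"
  unfolding seminorm_topology_def by (rule topology_generated_by_Basis) blast

lemma topspace_seminorm_topology:
  assumes "\<forall>p\<in>P. seminorm p" "P \<noteq> {}"
  shows "topspace (seminorm_topology P) = UNIV"
proof -
  obtain p where p: "p \<in> P" "seminorm p"
    using assms by auto
  then have "y \<in> {z. p (z - y) < 1}" for y
    by (simp add: seminorm_zero)
  then show ?thesis
    unfolding seminorm_topology_def topology_generated_by_topspace
    using p zero_less_one[where 'a=real] by blast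
qed

lemma limitin_seminorm_topology:
  assumes P: "\<forall>p\<in>P. seminorm p" "P \<noteq> {}"
  shows "limitin (seminorm_topology P) f l F \<longleftrightarrow> (\<forall>p\<in>P. ((\<lambda>i. p (f i - l)) \<longlongrightarrow> 0) F)"
proof (intro iffI ballI)
  fix p assume lim: "limitin (seminorm_topology P) f l F" and p: "p \<in> P"
  show "((\<lambda>i. p (f i - l)) \<longlongrightarrow> 0) F"
  proof (rule tendstoI)
    fix e :: real assume "e > 0"
    then have "openin (seminorm_topology P) {y. p (y - l) < e}" "l \<in> {y. p (y - l) < e}"
      using openin_seminorm_ball[OF p] seminorm_zero[OF bspec[OF P(1) p]] by auto
    then have "eventually (\<lambda>i. f i \<in> {y. p (y - l) < e}) F"
      using lim unfolding limitin_def by blast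
    then show "eventually (\<lambda>i. dist (p (f i - l)) 0 < e) F"
      by eventually_elim (use seminorm_nonneg[OF bspec[OF P(1) p]] in \<open>simp add: dist_real_def\<close>)
  qed
next
  assume lim: "\<forall>p\<in>P. ((\<lambda>i. p (f i - l)) \<longlongrightarrow> 0) F"
  have "eventually (\<lambda>i. f i \<in> U) F"
    if "generate_topology_on {{y. p (y - x) < e} | p x e. p \<in> P \<and> 0 < e} U" "l \<in> U" for U
    using that
  proof (induction rule: generate_topology_on.induct)
    case Empty
    then show ?case by simp
  next
    case (Int a b)
    then show ?case by (auto intro: eventually_conj)
  next
    case (UN K)
    then obtain k where k: "k \<in> K" "l \<in> k" by blast
    show ?case
      by (rule eventually_mono[OF UN.IH[OF k]]) (use k in blast)
  next
    case (Basis s)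
    then obtain p x e where s: "s = {y. p (y - x) < e}" "p \<in> P" by blast
    have "eventually (\<lambda>i. p (f i - l) < e - p (l - x)) F"
      using lim s Basis by (intro order_tendstoD(2)) auto
    then show ?case
    proof eventually_elim
      case (elim i)
      then show ?case
        using seminorm_diff_triangle[OF bspec[OF P(1) s(2)], of "f i" x l] by (simp add: s(1))
    qed
  qed
  then show "limitin (seminorm_topology P) f l F"
    unfolding limitin_def topspace_seminorm_topology[OF P]
    by (simp add: seminorm_topology_def openin_topology_generated_by_iff)
qed

lemma continuous_map_into_seminorm_topology:
  assumes P: "\<forall>p\<in>P. seminorm p" "P \<noteq> {}"
  shows "continuous_map X (seminorm_topology P) f \<longleftrightarrow>
    (\<forall>p\<in>P. \<forall>a\<in>topspace X. ((\<lambda>x. p (f x - f a)) \<longlongrightarrow> 0) (atin X a))"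
  unfolding continuous_map_atin limitin_seminorm_topology[OF P] by blast

lemma hausdorff_locally_convex_seminorm_topology:
  fixes P :: "('z::real_vector \<Rightarrow> real) set"
  assumes P: "\<forall>p\<in>P. seminorm p" "P \<noteq> {}"
    and sep: "\<And>x. x \<noteq> 0 \<Longrightarrow> \<exists>p\<in>P. p x \<noteq> 0"
  shows "hausdorff_locally_convex (seminorm_topology P)"
  unfolding hausdorff_locally_convex_def
proof (intro conjI allI impI)
  let ?\<tau> = "seminorm_topology P"
  have top: "topspace ?\<tau> = UNIV"
    using P by (rule topspace_seminorm_topology)
  then show "topspace ?\<tau> = UNIV" .
  show "Hausdorff_space ?\<tau>"
    unfolding Hausdorff_space_def
  proof (intro allI impI)
    fix x y assume "x \<in> topspace ?\<tau> \<and> y \<in> topspace ?\<tau> \<and> x \<noteq> y"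
    then obtain p where p: "p \<in> P" "p (x - y) \<noteq> 0"
      using sep[of "x - y"] by auto
    define r where "r = p (x - y) / 2"
    have r: "r > 0"
      using p seminorm_nonneg[OF bspec[OF P(1) p(1)], of "x - y"] by (simp add: r_def)
    have "\<not> p (z - y) < r" if "p (z - x) < r" for z
      using seminorm_diff_triangle[OF bspec[OF P(1) p(1)], of x y z] that
        seminorm_minus[OF bspec[OF P(1) p(1)], of "z - x"] by (simp add: r_def)
    then have "disjnt {z. p (z - x) < r} {z. p (z - y) < r}"
      unfolding disjnt_iff by blast
    then show "\<exists>U V. openin ?\<tau> U \<and> openin ?\<tau> V \<and> x \<in> U \<and> y \<in> V \<and> disjnt U V"
      using openin_seminorm_ball[OF p(1) r] r seminorm_zero[OF bspec[OF P(1) p(1)]]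
      by (intro exI[of _ "{z. p (z - x) < r}"] exI[of _ "{z. p (z - y) < r}"]) auto
  qed
  show "continuous_map (prod_topology ?\<tau> ?\<tau>) ?\<tau> (\<lambda>(x, y). x + y)"
    unfolding continuous_map_into_seminorm_topology[OF P]
  proof (intro ballI)
    fix p a assume p: "p \<in> P"
    have fst: "((\<lambda>x. p (fst x - fst a)) \<longlongrightarrow> 0) (atin (prod_topology ?\<tau> ?\<tau>) a)"
      using continuous_map_fst[of ?\<tau> ?\<tau>] p top
      unfolding continuous_map_into_seminorm_topology[OF P] by (cases a) simp
    have snd: "((\<lambda>x. p (snd x - snd a)) \<longlongrightarrow> 0) (atin (prod_topology ?\<tau> ?\<tau>) a)"
      using continuous_map_snd[of ?\<tau> ?\<tau>] p top
      unfolding continuous_map_into_seminorm_topology[OF P] by (cases a) simp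
    show "((\<lambda>x. p ((case x of (x, y) \<Rightarrow> x + y) - (case a of (x, y) \<Rightarrow> x + y))) \<longlongrightarrow> 0)
        (atin (prod_topology ?\<tau> ?\<tau>) a)"
    proof (rule tendsto_sandwich[OF _ _ tendsto_const])
      show "((\<lambda>x. p (fst x - fst a) + p (snd x - snd a)) \<longlongrightarrow> 0)
          (atin (prod_topology ?\<tau> ?\<tau>) a)"
        using tendsto_add[OF fst snd] by simp
      show "\<forall>\<^sub>F x in atin (prod_topology ?\<tau> ?\<tau>) a.
          p ((case x of (x, y) \<Rightarrow> x + y) - (case a of (x, y) \<Rightarrow> x + y))
            \<le> p (fst x - fst a) + p (snd x - snd a)"
        using seminorm_triangle[OF bspec[OF P(1) p], of "_ - fst a" "_ - snd a"]
        by (intro always_eventually) (simp add: case_prod_beta add_diff_add)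
    qed (simp add: seminorm_nonneg[OF bspec[OF P(1) p]])
  qed
  show "continuous_map (prod_topology euclideanreal ?\<tau>) ?\<tau> (\<lambda>(c, x). c *\<^sub>R x)"
    unfolding continuous_map_into_seminorm_topology[OF P]
  proof (intro ballI)
    fix p a assume p: "p \<in> P"
    let ?F = "atin (prod_topology euclideanreal ?\<tau>) a"
    have fst: "((\<lambda>x. fst x) \<longlongrightarrow> fst a) ?F"
      using continuous_map_fst[of euclideanreal ?\<tau>] top
      unfolding continuous_map_atin by (cases a) simp
    have snd: "((\<lambda>x. p (snd x - snd a)) \<longlongrightarrow> 0) ?F"
      using continuous_map_snd[of euclideanreal ?\<tau>] p top
      unfolding continuous_map_into_seminorm_topology[OF P] by (cases a) simp
    show "((\<lambda>x. p ((case x of (c, x) \<Rightarrow> c *\<^sub>R x) - (case a of (c, x) \<Rightarrow> c *\<^sub>R x))) \<longlongrightarrow> 0) ?F"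
    proof (rule tendsto_sandwich[OF _ _ tendsto_const])
      have "((\<lambda>x. \<bar>fst x\<bar> * p (snd x - snd a) + \<bar>fst x - fst a\<bar> * p (snd a)) \<longlongrightarrow>
          \<bar>fst a\<bar> * 0 + \<bar>fst a - fst a\<bar> * p (snd a)) ?F"
        by (intro tendsto_intros fst snd)
      then show "((\<lambda>x. \<bar>fst x\<bar> * p (snd x - snd a) + \<bar>fst x - fst a\<bar> * p (snd a)) \<longlongrightarrow> 0) ?F"
        by simp
      have "p (c *\<^sub>R x - d *\<^sub>R y) \<le> \<bar>c\<bar> * p (x - y) + \<bar>c - d\<bar> * p y" for c d x y
        using seminorm_triangle[OF bspec[OF P(1) p], of "c *\<^sub>R (x - y)" "(c - d) *\<^sub>R y"]
        unfolding seminorm_scaleR[OF bspec[OF P(1) p]] by (simp add: algebra_simps)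
      then show "\<forall>\<^sub>F x in ?F. p ((case x of (c, x) \<Rightarrow> c *\<^sub>R x) - (case a of (c, x) \<Rightarrow> c *\<^sub>R x))
          \<le> \<bar>fst x\<bar> * p (snd x - snd a) + \<bar>fst x - fst a\<bar> * p (snd a)"
        by (intro always_eventually) (simp add: case_prod_beta)
    qed (simp add: seminorm_nonneg[OF bspec[OF P(1) p]])
  qed
  fix U assume U: "openin ?\<tau> U \<and> 0 \<in> U"
  then have "generate_topology_on {{y. p (y - x) < e} | p x e. p \<in> P \<and> 0 < e} U" "0 \<in> U"
    by (simp_all add: seminorm_topology_def openin_topology_generated_by_iff)
  then show "\<exists>V. openin ?\<tau> V \<and> convex V \<and> 0 \<in> V \<and> V \<subseteq> U"
  proof (induction rule: generate_topology_on.induct)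
    case Empty
    then show ?case by simp
  next
    case (Int a b)
    then obtain V W where "openin ?\<tau> V" "convex V" "0 \<in> V" "V \<subseteq> a"
      "openin ?\<tau> W" "convex W" "0 \<in> W" "W \<subseteq> b" by blast
    then show ?case
      by (intro exI[of _ "V \<inter> W"]) (auto intro: convex_Int)
  next
    case (UN K)
    then obtain k where "k \<in> K" "0 \<in> k" by blast
    with UN.IH[of k] show ?case by blast
  next
    case (Basis s)
    then obtain p x e where s: "s = {y. p (y - x) < e}" "p \<in> P" "0 < e" by blast
    note sn = bspec[OF P(1) s(2)]
    have "convex s"
    proof (rule convexI)
      fix y z and u v :: real
      assume yz: "y \<in> s" "z \<in> s" and uv: "0 \<le> u" "0 \<le> v" "u + v = 1"
      have x: "x = u *\<^sub>R x + v *\<^sub>R x"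
        using uv by (simp flip: scaleR_add_left)
      have "p (u *\<^sub>R y + v *\<^sub>R z - x) = p (u *\<^sub>R (y - x) + v *\<^sub>R (z - x))"
        by (subst x) (simp add: algebra_simps)
      also have "\<dots> \<le> u * p (y - x) + v * p (z - x)"
        using seminorm_triangle[OF sn, of "u *\<^sub>R (y - x)" "v *\<^sub>R (z - x)"] uv
        by (simp add: seminorm_scaleR[OF sn])
      also have "\<dots> < e"
        using yz uv by (intro convex_bound_lt) (auto simp: s)
      finally show "u *\<^sub>R y + v *\<^sub>R z \<in> s" by (simp add: s)
    qed
    moreover have "openin ?\<tau> s"
      using s openin_seminorm_ball by blast
    ultimately show ?case
      using Basis by blast
  qed
qed

section \<open>Sequential equicontinuity through selections\<close>

text \<open>
  Uniformity over an index set is convergence along every choice of one index per stage.  This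
  is what makes the seminorms \<open>\<bar>\<integral> f d\<mu>\<bar>\<close> harmless: along a selection there is only one sequence of
  functions, to which dominated convergence applies, whereas a direct estimate uniform in \<open>t\<close>
  would need a measurable dominating function for a supremum over uncountably many \<open>t\<close>.
\<close>

lemma seq_equicontinuous_iff_selections:
  assumes "topspace \<tau> = UNIV"
  shows "seq_equicontinuous \<tau> I f \<longleftrightarrow>
    (\<forall>zs z. \<forall>i :: nat \<Rightarrow> _. limitin \<tau> zs z sequentially \<longrightarrow> (\<forall>n. i n \<in> I) \<longrightarrow>
      limitin \<tau> (\<lambda>n. f (i n) (zs n) - f (i n) z) 0 sequentially)"
proof -
  have image_iff: "a \<in> (\<lambda>u. b + u) ` U \<longleftrightarrow> a - b \<in> U" for a b :: 'a and U
    by (auto simp: image_iff) (metis add.commute diff_add_cancel)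
  show ?thesis
    unfolding seq_equicontinuous_def image_iff
  proof (intro iffI allI impI)
    fix zs z and i :: "nat \<Rightarrow> _"
    assume eq: "\<forall>zs z. limitin \<tau> zs z sequentially \<longrightarrow>
        (\<forall>U. openin \<tau> U \<and> 0 \<in> U \<longrightarrow> (\<exists>N. \<forall>i\<in>I. \<forall>n\<ge>N. f i (zs n) - f i z \<in> U))"
      and lim: "limitin \<tau> zs z sequentially" and i: "\<forall>n. i n \<in> I"
    have "\<exists>N. \<forall>n\<ge>N. f (i n) (zs n) - f (i n) z \<in> U" if "openin \<tau> U" "0 \<in> U" for U
      using eq lim i that by meson
    then show "limitin \<tau> (\<lambda>n. f (i n) (zs n) - f (i n) z) 0 sequentially"
      by (simp add: limitin_def eventually_sequentially assms)
  next
    fix zs z U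
    assume sel: "\<forall>zs z. \<forall>i :: nat \<Rightarrow> _. limitin \<tau> zs z sequentially \<longrightarrow> (\<forall>n. i n \<in> I) \<longrightarrow>
        limitin \<tau> (\<lambda>n. f (i n) (zs n) - f (i n) z) 0 sequentially"
      and lim: "limitin \<tau> zs z sequentially" and U: "openin \<tau> U \<and> 0 \<in> U"
    show "\<exists>N. \<forall>i\<in>I. \<forall>n\<ge>N. f i (zs n) - f i z \<in> U"
    proof (cases "I = {}")
      case False
      \<comment> \<open>At each stage pick an index that leaves the neighbourhood whenever there is one.
        From the stage on where the picked index stays inside, so do all the others.\<close>
      define i where "i n = (SOME j. j \<in> I \<and> ((\<exists>j\<in>I. f j (zs n) - f j z \<notin> U) \<longrightarrow>
          f j (zs n) - f j z \<notin> U))" for n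
      have i: "i n \<in> I" "(\<exists>j\<in>I. f j (zs n) - f j z \<notin> U) \<longrightarrow> f (i n) (zs n) - f (i n) z \<notin> U" for n
      proof -
        have "\<exists>j. j \<in> I \<and> ((\<exists>j\<in>I. f j (zs n) - f j z \<notin> U) \<longrightarrow> f j (zs n) - f j z \<notin> U)"
          using False by blast
        from someI_ex[OF this] show "i n \<in> I"
            "(\<exists>j\<in>I. f j (zs n) - f j z \<notin> U) \<longrightarrow> f (i n) (zs n) - f (i n) z \<notin> U"
          unfolding i_def by blast+
      qed
      have "limitin \<tau> (\<lambda>n. f (i n) (zs n) - f (i n) z) 0 sequentially"
        using sel lim i(1) by blast
      then obtain N where "\<forall>n\<ge>N. f (i n) (zs n) - f (i n) z \<in> U"
        using U unfolding limitin_def eventually_sequentially by blast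
      then show ?thesis
        using i(2) by blast
    qed auto
  qed
qed

section \<open>Suprema on compact sets\<close>

lemma apply_ucb_eqI: "(\<And>x. apply_ucb f x = apply_ucb g x) \<Longrightarrow> f = g"
  by (metis apply_ucb_def bcontfun_eqI bcontfun_of_ucb_inject)

lemma uniformly_continuous_apply_ucb: "uniformly_continuous_on UNIV (apply_ucb f)"
  and bounded_apply_ucb: "bounded (range (apply_ucb f))"
  using range_apply_ucb by (metis (mono_tags, lifting) mem_Collect_eq rangeI)+

lemma obtain_ucb:
  assumes "bounded (range h)" "uniformly_continuous_on UNIV h"
  obtains f where "apply_ucb f = h"
  using assms range_apply_ucb by (metis (mono_tags, lifting) mem_Collect_eq rangeE)

lemma bdd_above_apply_ucb: "bdd_above ((\<lambda>x. \<bar>apply_ucb f x\<bar>) ` A)"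
  using bounded_apply_ucb[of f]
  by (auto simp: bounded_iff bdd_above_def)

lemma abs_apply_ucb_le_norm: "\<bar>apply_ucb f x\<bar> \<le> norm f"
  unfolding norm_ucb_eq_SUP by (rule cSUP_upper[OF UNIV_I bdd_above_apply_ucb])

lemma norm_ucb_leI: "(\<And>x. \<bar>apply_ucb f x\<bar> \<le> C) \<Longrightarrow> norm f \<le> C"
  unfolding norm_ucb_eq_SUP by (rule cSUP_least) auto

lemma norm_ucb_attained_up_to:
  assumes "c < 1" "f \<noteq> 0"
  obtains x where "c * norm f \<le> \<bar>apply_ucb f x\<bar>"
proof -
  have "c * norm f < 1 * norm f"
    using assms by (intro mult_strict_right_mono) auto
  then have "c * norm f < (SUP x. \<bar>apply_ucb f x\<bar>)"
    by (simp add: norm_ucb_eq_SUP)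
  then obtain x where x: "c * norm f < \<bar>apply_ucb f x\<bar>"
    using less_cSUP_iff[OF _ bdd_above_apply_ucb, of UNIV] by auto
  then show thesis
    using that[of x] by simp
qed

lemma continuous_apply_ucb: "continuous_on UNIV (apply_ucb f)"
  by (rule uniformly_continuous_imp_continuous[OF uniformly_continuous_apply_ucb])

lemma borel_measurable_apply_ucb [measurable]: "apply_ucb f \<in> borel_measurable borel"
  by (rule borel_measurable_continuous_onI[OF continuous_apply_ucb])

lemma abs_apply_ucb_le_sup_on: "x \<in> K \<Longrightarrow> \<bar>apply_ucb f x\<bar> \<le> sup_on K f"
  unfolding sup_on_def by (rule cSUP_upper[OF _ bdd_above_apply_ucb])

lemma sup_on_leI: "K \<noteq> {} \<Longrightarrow> (\<And>x. x \<in> K \<Longrightarrow> \<bar>apply_ucb f x\<bar> \<le> C) \<Longrightarrow> sup_on K f \<le> C"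
  unfolding sup_on_def by (rule cSUP_least) auto

lemma sup_on_le_norm: "K \<noteq> {} \<Longrightarrow> sup_on K f \<le> norm f"
  by (simp add: sup_on_leI abs_apply_ucb_le_norm)

lemma sup_on_triangle: "K \<noteq> {} \<Longrightarrow> sup_on K (f + g) \<le> sup_on K f + sup_on K g"
  by (intro sup_on_leI) (auto intro!: order.trans[OF abs_triangle_ineq] add_mono abs_apply_ucb_le_sup_on)

lemma sup_on_nonneg: "K \<noteq> {} \<Longrightarrow> 0 \<le> sup_on K f"
  using abs_apply_ucb_le_sup_on by (metis abs_ge_zero equals0I order.trans)

lemma sup_on_scaleR:
  assumes "K \<noteq> {}"
  shows "sup_on K (c *\<^sub>R f) = \<bar>c\<bar> * sup_on K f"
proof -
  have le: "sup_on K (c *\<^sub>R f) \<le> \<bar>c\<bar> * sup_on K f" for c f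
    using assms by (intro sup_on_leI) (auto simp: abs_mult intro!: mult_left_mono abs_apply_ucb_le_sup_on)
  show ?thesis
  proof (cases "c = 0")
    case True
    then show ?thesis using le[of c f] sup_on_nonneg[OF assms, of 0] by simp
  next
    case False
    then have "\<bar>c\<bar> * sup_on K f \<le> sup_on K (c *\<^sub>R f)"
      using le[of "inverse c" "c *\<^sub>R f"] by (simp add: field_simps)
    with le[of c f] show ?thesis by simp
  qed
qed

lemma seminorm_sup_on: "K \<noteq> {} \<Longrightarrow> seminorm (sup_on K)"
  unfolding seminorm_def using sup_on_triangle sup_on_scaleR by blast

section \<open>Integration against signed measures\<close>

lemma ca_sums:
  "\<mu> \<in> ca \<Longrightarrow> range A \<subseteq> sets borel \<Longrightarrow> disjoint_family A \<Longrightarrow> (\<lambda>n::nat. \<mu> (A n)) sums \<mu> (\<Union>n. A n)"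
  by (simp add: ca_def)

lemma ca_empty:
  assumes "\<mu> \<in> ca"
  shows "\<mu> {} = 0"
proof -
  have "(\<lambda>n::nat. \<mu> {}) sums \<mu> {}"
    using ca_sums[OF assms, of "\<lambda>_. {}"] by (simp add: disjoint_family_on_def)
  then have "(\<lambda>n::nat. \<mu> {}) \<longlonglongrightarrow> 0"
    using summable_LIMSEQ_zero sums_summable by blast
  then show ?thesis
    using LIMSEQ_unique tendsto_const by blast
qed

lemma ca_Un:
  assumes \<mu>: "\<mu> \<in> ca" and AB: "A \<in> sets borel" "B \<in> sets borel" "A \<inter> B = {}"
  shows "\<mu> (A \<union> B) = \<mu> A + \<mu> B"
proof -
  have "(\<lambda>n. \<mu> (binaryset A B n)) sums \<mu> (\<Union>n. binaryset A B n)"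
    using AB by (intro ca_sums[OF \<mu>]) (auto simp: range_binaryset_eq disjoint_family_on_def binaryset_def)
  moreover have "(\<lambda>n. \<mu> (binaryset A B n)) sums (\<mu> A + \<mu> B)"
    using AB ca_empty[OF \<mu>] binaryset_sums[of \<mu> A B] by simp
  ultimately show ?thesis
    using sums_unique2 by (fastforce simp: UN_binaryset_eq)
qed

text \<open>
  If \<open>\<mu>\<close> were unbounded on the Borel subsets of \<open>A\<close>, some \<open>B \<subseteq> A\<close> would have \<open>\<bar>\<mu> B\<bar> > \<bar>\<mu> A\<bar> + 1\<close>, so
  that both \<open>B\<close> and \<open>A - B\<close> have measure at least \<open>1\<close> in absolute value, and \<open>\<mu>\<close> would still be
  unbounded on one of the two.  Retaining that one and repeating discards infinitely many disjoint
  sets of measure at least \<open>1\<close>, against countable additivity.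
\<close>

lemma ca_bounded:
  fixes \<mu> :: "'a::topological_space set \<Rightarrow> real"
  assumes \<mu>: "\<mu> \<in> ca"
  shows "\<exists>C. \<forall>B\<in>sets borel. \<bar>\<mu> B\<bar> \<le> C"
proof (rule ccontr)
  define unbdd where "unbdd A \<longleftrightarrow> A \<in> sets borel \<and> (\<forall>C. \<exists>B\<in>sets borel. B \<subseteq> A \<and> \<bar>\<mu> B\<bar> > C)" for A
  assume "\<not> ?thesis"
  then have UNIV: "unbdd UNIV"
    unfolding unbdd_def using sets.top[of borel] by (metis not_le space_borel subset_UNIV)
  have halve: "\<exists>B. unbdd B \<and> B \<subseteq> A \<and> \<bar>\<mu> (A - B)\<bar> \<ge> 1" if A: "unbdd A" for A
  proof -
    obtain B where B: "B \<in> sets borel" "B \<subseteq> A" "\<bar>\<mu> B\<bar> > \<bar>\<mu> A\<bar> + 1"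
      using A unfolding unbdd_def by blast
    have A': "A \<in> sets borel" using A by (simp add: unbdd_def)
    have "\<mu> A = \<mu> B + \<mu> (A - B)"
      using ca_Un[OF \<mu>, of B "A - B"] B A' by (simp add: Un_absorb1)
    then have big: "\<bar>\<mu> (A - B)\<bar> \<ge> 1" "\<bar>\<mu> B\<bar> \<ge> 1"
      using B by linarith+
    have "unbdd B \<or> unbdd (A - B)"
    proof (rule ccontr)
      assume "\<not> (unbdd B \<or> unbdd (A - B))"
      then obtain C D where CD: "\<forall>X\<in>sets borel. X \<subseteq> B \<longrightarrow> \<bar>\<mu> X\<bar> \<le> C"
          "\<forall>X\<in>sets borel. X \<subseteq> A - B \<longrightarrow> \<bar>\<mu> X\<bar> \<le> D"
        using A' B unfolding unbdd_def by (metis not_le sets.Diff)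
      obtain X where X: "X \<in> sets borel" "X \<subseteq> A" "\<bar>\<mu> X\<bar> > C + D"
        using A unfolding unbdd_def by blast
      have "\<mu> X = \<mu> (X \<inter> B) + \<mu> (X - B)"
        using ca_Un[OF \<mu>, of "X \<inter> B" "X - B"] X B
        by (metis Diff_disjoint Int_Diff_Un Int_commute inf_left_commute inf_bot_right sets.Diff sets.Int)
      moreover have "\<bar>\<mu> (X \<inter> B)\<bar> \<le> C" "\<bar>\<mu> (X - B)\<bar> \<le> D"
        using CD X(1,2) B(1) by (meson Diff_mono Int_lower2 order_refl sets.Diff sets.Int)+
      ultimately show False using X by linarith
    qed
    then show ?thesis
    proof
      assume "unbdd B"
      with B big show ?thesis by blast
    next
      assume "unbdd (A - B)"
      moreover have "A - (A - B) = B" using B by blast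
      ultimately show ?thesis using big by (intro exI[of _ "A - B"]) auto
    qed
  qed
  have "\<exists>A. \<forall>n::nat. unbdd (A n) \<and> (A (Suc n) \<subseteq> A n \<and> \<bar>\<mu> (A n - A (Suc n))\<bar> \<ge> 1)"
    by (rule dependent_nat_choice) (use UNIV halve in auto)
  then obtain A where A: "\<And>n. unbdd (A n)" "\<And>n::nat. A (Suc n) \<subseteq> A n"
      "\<And>n. \<bar>\<mu> (A n - A (Suc n))\<bar> \<ge> 1"
    by blast
  have "decseq A" using A(2) by (rule decseq_SucI)
  then have "disjoint_family (\<lambda>n. A n - A (Suc n))"
  proof -
    have "A n \<subseteq> A (Suc m)" if "m < n" for m n
      using \<open>decseq A\<close> that by (simp add: decseqD)
    then have "(A m - A (Suc m)) \<inter> (A n - A (Suc n)) = {}" if "m < n" for m n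
      using that by blast
    then show ?thesis
      unfolding disjoint_family_on_def by (metis Int_commute linorder_neqE_nat)
  qed
  moreover have "range (\<lambda>n. A n - A (Suc n)) \<subseteq> sets borel"
    using A(1) unfolding unbdd_def by auto
  ultimately have "(\<lambda>n. \<mu> (A n - A (Suc n))) \<longlonglongrightarrow> 0"
    using ca_sums[OF \<mu>] summable_LIMSEQ_zero sums_summable by blast
  then have "eventually (\<lambda>n. \<bar>\<mu> (A n - A (Suc n))\<bar> < 1) sequentially"
    using order_tendstoD(2)[OF tendsto_rabs_zero, of _ _ 1] by simp
  then show False
    using A(3) by (simp add: not_less[symmetric])
qed

lemma ca_uminus: "\<mu> \<in> ca \<Longrightarrow> (\<lambda>A. - \<mu> A) \<in> ca"
  by (simp add: ca_def sums_minus)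

lemma sets_upper_variation [measurable_cong, simp]: "sets (upper_variation \<mu>) = sets borel"
  unfolding upper_variation_def
  using sets.sigma_sets_eq[of borel] by (subst sets_measure_of) auto

lemma space_upper_variation [simp]: "space (upper_variation \<mu>) = UNIV"
  by (simp add: sets_eq_imp_space_eq[OF sets_upper_variation])

text \<open>
  The generated measure never exceeds the set function that generates it: it is that set function
  if this is countably additive, and zero otherwise.  So finiteness follows from a bound on \<open>\<mu>\<close>.
\<close>

lemma finite_measure_upper_variation:
  assumes "\<mu> \<in> ca"
  shows "finite_measure (upper_variation \<mu>)"
proof
  obtain C where C: "\<forall>B\<in>sets borel. \<bar>\<mu> B\<bar> \<le> C"
    using ca_bounded[OF assms] by blast
  have "emeasure (upper_variation \<mu>) UNIV \<le> (SUP B\<in>{B \<in> sets borel. B \<subseteq> UNIV}. ennreal (\<mu> B))"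
    unfolding upper_variation_def emeasure_measure_of_conv by auto
  also have "\<dots> \<le> ennreal C"
    using C by (intro SUP_least ennreal_leI) (auto dest: abs_le_D1)
  finally show "emeasure (upper_variation \<mu>) (space (upper_variation \<mu>)) \<noteq> \<infinity>"
    by (auto simp: top_unique)
qed

lemma integrable_apply_ucb:
  assumes "finite_measure M" "sets M = sets borel"
  shows "integrable M (apply_ucb f)"
proof -
  interpret finite_measure M by fact
  show ?thesis
    using assms(2) abs_apply_ucb_le_norm[of f]
    by (intro integrable_const_bound[where B="norm f"]) (auto cong: measurable_cong_sets)
qed

lemma integrable_upper_variation:
  "\<mu> \<in> ca \<Longrightarrow> integrable (upper_variation \<mu>) (apply_ucb f)"
  by (simp add: integrable_apply_ucb finite_measure_upper_variation)

lemma signed_integral_add: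
  "\<mu> \<in> ca \<Longrightarrow> signed_integral \<mu> (apply_ucb (f + g)) =
     signed_integral \<mu> (apply_ucb f) + signed_integral \<mu> (apply_ucb g)"
  by (simp add: signed_integral_def integrable_upper_variation ca_uminus)

lemma signed_integral_scaleR:
  "signed_integral \<mu> (apply_ucb (c *\<^sub>R f)) = c * signed_integral \<mu> (apply_ucb f)"
  by (simp add: signed_integral_def right_diff_distrib)

lemma signed_integral_dominated_convergence:
  assumes \<mu>: "\<mu> \<in> ca" and C: "\<And>n. norm (fs n) \<le> C"
    and lim: "\<And>x. (\<lambda>n. apply_ucb (fs n) x) \<longlonglongrightarrow> 0"
  shows "(\<lambda>n. signed_integral \<mu> (apply_ucb (fs n))) \<longlonglongrightarrow> 0"
proof -
  have "(\<lambda>n. \<integral>x. apply_ucb (fs n) x \<partial>upper_variation \<nu>) \<longlonglongrightarrow> (\<integral>x. 0 \<partial>upper_variation \<nu>)"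
    if \<nu>: "\<nu> \<in> ca" for \<nu>
  proof (rule integral_dominated_convergence[where w="\<lambda>_. C"])
    interpret finite_measure "upper_variation \<nu>"
      by (rule finite_measure_upper_variation[OF \<nu>])
    show "integrable (upper_variation \<nu>) (\<lambda>_. C)" by simp
    show "AE x in upper_variation \<nu>. norm (apply_ucb (fs n) x) \<le> C" for n
      using order.trans[OF abs_apply_ucb_le_norm C] by simp
  qed (use lim in auto)
  from tendsto_diff[OF this[OF \<mu>] this[OF ca_uminus[OF \<mu>]]] show ?thesis
    by (simp add: signed_integral_def)
qed

lemma signed_integral_bound:
  assumes \<mu>: "\<mu> \<in> ca"
  obtains C where "\<And>f. \<bar>signed_integral \<mu> (apply_ucb f)\<bar> \<le> C * norm f"
proof -
  have *: "\<bar>\<integral>x. apply_ucb f x \<partial>upper_variation \<nu>\<bar> \<le> measure (upper_variation \<nu>) UNIV * norm f"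
    if \<nu>: "\<nu> \<in> ca" for \<nu> and f :: "'a ucb"
  proof -
    interpret finite_measure "upper_variation \<nu>"
      by (rule finite_measure_upper_variation[OF \<nu>])
    have "\<bar>\<integral>x. apply_ucb f x \<partial>upper_variation \<nu>\<bar> \<le> (\<integral>x. \<bar>apply_ucb f x\<bar> \<partial>upper_variation \<nu>)"
      by (rule integral_abs_bound)
    also have "\<dots> \<le> (\<integral>x. norm f \<partial>upper_variation \<nu>)"
      by (intro integral_mono integrable_abs integrable_upper_variation[OF \<nu>])
        (simp_all add: abs_apply_ucb_le_norm)
    finally show ?thesis by simp
  qed
  show thesis
  proof (rule that)
    fix f :: "'a ucb"
    show "\<bar>signed_integral \<mu> (apply_ucb f)\<bar> \<le>
        (measure (upper_variation \<mu>) UNIV + measure (upper_variation (\<lambda>A. - \<mu> A)) UNIV) * norm f"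
      using *[OF \<mu>, of f] *[OF ca_uminus[OF \<mu>], of f] unfolding signed_integral_def distrib_right
      by linarith
  qed
qed

lemma finite_borel_measure_ca:
  assumes "finite_measure M" "sets M = sets borel"
  shows "measure M \<in> ca"
proof -
  interpret finite_measure M by fact
  show ?thesis
    unfolding ca_def by (auto simp flip: assms(2) intro: finite_measure_UNION)
qed

text \<open>
  A positive measure is its own upper variation, since the supremum over the subsets of \<open>A\<close> is
  attained at \<open>A\<close>; its lower variation vanishes, since \<^const>\<open>ennreal\<close> truncates at \<open>0\<close>.
\<close>

lemma signed_integral_finite_borel_measure:
  fixes M :: "'a::topological_space measure"
  assumes M: "finite_measure M" "sets M = sets borel"
  shows "signed_integral (measure M) f = (\<integral>x. f x \<partial>M)"
proof -
  interpret finite_measure M by fact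
  have space: "space M = UNIV"
    using sets_eq_imp_space_eq[OF M(2)] by simp
  have "upper_variation (measure M) = measure_of UNIV (sets borel) (emeasure M)"
    unfolding upper_variation_def
  proof (rule measure_of_eq)
    fix A :: "'a set" assume "A \<in> sigma_sets UNIV (sets borel)"
    then have A: "A \<in> sets M"
      using sets.sigma_sets_eq[of "borel :: 'a measure"] M(2) by simp
    show "(SUP B\<in>{B \<in> sets borel. B \<subseteq> A}. ennreal (measure M B)) = emeasure M A"
    proof (rule antisym)
      show "(SUP B\<in>{B \<in> sets borel. B \<subseteq> A}. ennreal (measure M B)) \<le> emeasure M A"
        using A by (intro SUP_least) (auto simp flip: emeasure_eq_measure intro: emeasure_mono)
      show "emeasure M A \<le> (SUP B\<in>{B \<in> sets borel. B \<subseteq> A}. ennreal (measure M B))"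
        using A M(2) by (intro SUP_upper2[of A]) (auto simp: emeasure_eq_measure)
    qed
  qed simp
  also have "\<dots> = M"
    using measure_of_of_measure[of M] by (simp add: space M(2))
  finally have pos: "upper_variation (measure M) = M" .
  have "emeasure (upper_variation (\<lambda>A. - measure M A)) UNIV = 0"
    unfolding upper_variation_def emeasure_measure_of_conv
    by (auto simp: ennreal_neg intro!: SUP_eq_const)
  then have "AE x in upper_variation (\<lambda>A. - measure M A). False"
    by (intro AE_I[of _ _ UNIV]) (auto simp: sets.top[of borel, simplified])
  then have "(\<integral>x. f x \<partial>upper_variation (\<lambda>A. - measure M A)) = 0"
    by (intro integral_eq_zero_AE) auto
  then show ?thesis
    unfolding signed_integral_def pos by simp
qed

section \<open>Convergent sequences of the topology\<close>

lemma seminorm_tauK_seminorm: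
  assumes "K \<noteq> {}" "\<mu> \<in> ca"
  shows "seminorm (tauK_seminorm K \<mu>)"
  unfolding seminorm_def tauK_seminorm_def
proof (intro conjI allI)
  fix f g :: "'a ucb" and c :: real
  show "sup_on K (f + g) + \<bar>signed_integral \<mu> (apply_ucb (f + g))\<bar> \<le>
      sup_on K f + \<bar>signed_integral \<mu> (apply_ucb f)\<bar> + (sup_on K g + \<bar>signed_integral \<mu> (apply_ucb g)\<bar>)"
    using sup_on_triangle[OF assms(1), of f g] by (simp add: signed_integral_add[OF assms(2)])
  show "sup_on K (c *\<^sub>R f) + \<bar>signed_integral \<mu> (apply_ucb (c *\<^sub>R f))\<bar> =
      \<bar>c\<bar> * (sup_on K f + \<bar>signed_integral \<mu> (apply_ucb f)\<bar>)"
    unfolding sup_on_scaleR[OF assms(1)] signed_integral_scaleR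
    by (simp add: abs_mult distrib_left)
qed

lemma zero_in_ca: "(\<lambda>_. 0) \<in> ca"
  by (simp add: ca_def)

lemma tauK_seminorms:
  "\<forall>p\<in>{tauK_seminorm K \<mu> | K \<mu>. compact K \<and> K \<noteq> {} \<and> \<mu> \<in> ca}. seminorm p"
  "{tauK_seminorm K \<mu> | K \<mu>. compact K \<and> K \<noteq> {} \<and> \<mu> \<in> ca} \<noteq> {}"
  using seminorm_tauK_seminorm zero_in_ca compact_insert[OF compact_empty] by blast+

lemma topspace_tauK: "topspace tauK = UNIV"
  unfolding tauK_def by (rule topspace_seminorm_topology[OF tauK_seminorms])

lemma hausdorff_locally_convex_tauK: "hausdorff_locally_convex tauK"
  unfolding tauK_def
proof (rule hausdorff_locally_convex_seminorm_topology[OF tauK_seminorms])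
  fix f :: "'a ucb" assume "f \<noteq> 0"
  then obtain x where "apply_ucb f x \<noteq> 0"
    using apply_ucb_eqI[of f 0] by auto
  then have "tauK_seminorm {x} (\<lambda>_. 0) f \<noteq> 0"
    using abs_apply_ucb_le_sup_on[of x "{x}" f] by (simp add: tauK_seminorm_def)
  then show "\<exists>p\<in>{tauK_seminorm K \<mu> | K \<mu>. compact K \<and> K \<noteq> {} \<and> \<mu> \<in> ca}. p f \<noteq> 0"
    using zero_in_ca compact_insert[OF compact_empty, of x] by blast
qed

lemma limitin_tauK:
  "limitin tauK f l F \<longleftrightarrow>
    (\<forall>K. compact K \<and> K \<noteq> {} \<longrightarrow> ((\<lambda>i. sup_on K (f i - l)) \<longlongrightarrow> 0) F) \<and>
    (\<forall>\<mu>\<in>ca. ((\<lambda>i. signed_integral \<mu> (apply_ucb (f i - l))) \<longlongrightarrow> 0) F)" (is "?L \<longleftrightarrow> ?R")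
proof -
  have "?L \<longleftrightarrow> (\<forall>K \<mu>. compact K \<and> K \<noteq> {} \<and> \<mu> \<in> ca \<longrightarrow>
      ((\<lambda>i. tauK_seminorm K \<mu> (f i - l)) \<longlongrightarrow> 0) F)"
    unfolding tauK_def limitin_seminorm_topology[OF tauK_seminorms] by blast
  also have "\<dots> \<longleftrightarrow> (\<forall>K \<mu>. compact K \<and> K \<noteq> {} \<and> \<mu> \<in> ca \<longrightarrow>
      ((\<lambda>i. sup_on K (f i - l)) \<longlongrightarrow> 0) F \<and>
      ((\<lambda>i. signed_integral \<mu> (apply_ucb (f i - l))) \<longlongrightarrow> 0) F)"
  proof -
    have "((\<lambda>i. tauK_seminorm K \<mu> (f i - l)) \<longlongrightarrow> 0) F \<longleftrightarrow>
      ((\<lambda>i. sup_on K (f i - l)) \<longlongrightarrow> 0) F \<and>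
      ((\<lambda>i. signed_integral \<mu> (apply_ucb (f i - l))) \<longlongrightarrow> 0) F" if "K \<noteq> {}" for K \<mu>
    proof (intro iffI conjI)
      assume lim: "((\<lambda>i. tauK_seminorm K \<mu> (f i - l)) \<longlongrightarrow> 0) F"
      show "((\<lambda>i. sup_on K (f i - l)) \<longlongrightarrow> 0) F"
        by (rule Lim_null_comparison[OF _ lim])
          (simp add: tauK_seminorm_def sup_on_nonneg[OF that])
      show "((\<lambda>i. signed_integral \<mu> (apply_ucb (f i - l))) \<longlongrightarrow> 0) F"
        by (rule Lim_null_comparison[OF _ lim])
          (simp add: tauK_seminorm_def sup_on_nonneg[OF that])
    next
      assume "((\<lambda>i. sup_on K (f i - l)) \<longlongrightarrow> 0) F \<and>
        ((\<lambda>i. signed_integral \<mu> (apply_ucb (f i - l))) \<longlongrightarrow> 0) F"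
      then show "((\<lambda>i. tauK_seminorm K \<mu> (f i - l)) \<longlongrightarrow> 0) F"
        unfolding tauK_seminorm_def by (intro tendsto_add_zero tendsto_rabs_zero) auto
    qed
    then show ?thesis by blast
  qed
  also have "\<dots> \<longleftrightarrow> ?R"
    using zero_in_ca compact_insert[OF compact_empty] by blast
  finally show ?thesis .
qed

lemma tendsto_apply_ucb_zero:
  assumes "((\<lambda>i. sup_on {x} (f i)) \<longlongrightarrow> 0) F"
  shows "((\<lambda>i. apply_ucb (f i) x) \<longlongrightarrow> 0) F"
  using assms abs_apply_ucb_le_sup_on[of x "{x}"]
  by (intro Lim_null_comparison[OF _ assms]) simp

lemma limitin_tauK_of_norm:
  fixes f :: "'i \<Rightarrow> 'a::metric_space ucb"
  assumes "((\<lambda>i. norm (f i - l)) \<longlongrightarrow> 0) F"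
  shows "limitin tauK f l F"
  unfolding limitin_tauK
proof (intro conjI allI impI ballI)
  fix K :: "'a set" assume "compact K \<and> K \<noteq> {}"
  then show "((\<lambda>i. sup_on K (f i - l)) \<longlongrightarrow> 0) F"
    by (intro Lim_null_comparison[OF _ assms]) (simp add: sup_on_nonneg sup_on_le_norm)
next
  fix \<mu> :: "'a set \<Rightarrow> real" assume "\<mu> \<in> ca"
  then obtain C where C: "\<And>f. \<bar>signed_integral \<mu> (apply_ucb f)\<bar> \<le> C * norm f"
    using signed_integral_bound by blast
  show "((\<lambda>i. signed_integral \<mu> (apply_ucb (f i - l))) \<longlongrightarrow> 0) F"
    by (rule Lim_null_comparison[OF _ tendsto_mult_right_zero[OF assms, of C]])
      (unfold real_norm_def, intro always_eventually allI C)
qed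

text \<open>
  Given peaks \<open>x k\<close> of the functions \<open>g k\<close>, the weights are chosen one after the other.  The weight of
  the \<open>k\<close>-th peak is \<open>0\<close> or \<open>4\<^sup>-\<^sup>k\<close>; the two candidate values of the partial sum for \<open>g k\<close> differ by at
  least \<open>5/6 \<cdot> 4\<^sup>-\<^sup>k \<cdot> G k\<close>, so one of them is at least \<open>5/12 \<cdot> 4\<^sup>-\<^sup>k \<cdot> G k\<close> in absolute value.  All later weights
  together contribute at most \<open>4\<^sup>-\<^sup>k \<cdot> G k / 3\<close>, which leaves \<open>4\<^sup>-\<^sup>k \<cdot> G k / 12\<close>.
\<close>

lemma gliding_hump_weights:
  fixes g :: "nat \<Rightarrow> 'a \<Rightarrow> real" and x :: "nat \<Rightarrow> 'a" and G :: "nat \<Rightarrow> real"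
  assumes bound: "\<And>k y. \<bar>g k y\<bar> \<le> G k" and peak: "\<And>k. 5 / 6 * G k \<le> \<bar>g k (x k)\<bar>"
  obtains c :: "nat \<Rightarrow> real" where "\<And>j. c j \<in> {0, (1/4)^j}"
    "\<And>k. (1/4)^k * G k / 12 \<le> \<bar>\<Sum>j. c j * g k (x j)\<bar>"
proof -
  define P where "P c k r \<longleftrightarrow> r \<in> {0, (1/4)^k} \<and>
      5/12 * ((1/4)^k * G k) \<le> \<bar>(\<Sum>j<k. c j * g k (x j)) + r * g k (x k)\<bar>"
    for c :: "nat \<Rightarrow> real" and k r
  have "\<exists>c. \<forall>k. P c k (c k)"
  proof (rule dependent_wf_choice[OF wf_less])
    show "P c k r = P d k r" if "\<And>z. (z, k) \<in> {(x, y). x < y} \<Longrightarrow> c z = d z" for c d k r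
    proof -
      have "(\<Sum>j<k. c j * g k (x j)) = (\<Sum>j<k. d j * g k (x j))"
        using that by (intro sum.cong) auto
      then show ?thesis by (simp only: P_def)
    qed
    fix k and c :: "nat \<Rightarrow> real"
    define S where "S = (\<Sum>j<k. c j * g k (x j))"
    have "5/6 * ((1/4)^k * G k) \<le> \<bar>(1/4)^k * g k (x k)\<bar>"
      using mult_left_mono[OF peak[of k], of "(1/4)^k"] by (simp add: abs_mult mult_ac)
    also have "\<dots> \<le> \<bar>S + (1/4)^k * g k (x k)\<bar> + \<bar>S + 0 * g k (x k)\<bar>"
      by simp
    finally have "5/12 * ((1/4)^k * G k) \<le> \<bar>S + (1/4)^k * g k (x k)\<bar> \<or>
        5/12 * ((1/4)^k * G k) \<le> \<bar>S + 0 * g k (x k)\<bar>"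
      by linarith
    then show "\<exists>r. P c k r"
      unfolding P_def S_def by blast
  qed
  then obtain c where c: "\<And>k. P c k (c k)" by blast
  have c01: "c j \<in> {0, (1/4)^j}" for j
    using c unfolding P_def by blast
  have "(1/4)^k * G k / 12 \<le> \<bar>\<Sum>j. c j * g k (x j)\<bar>" for k
  proof -
    have summand: "\<bar>c j * g k (x j)\<bar> \<le> G k * (1/4)^j" for j
    proof -
      have "\<bar>c j\<bar> \<le> (1/4)^j" using c01[of j] by auto
      from mult_mono[OF this bound[of k "x j"]] show ?thesis
        by (simp add: abs_mult mult.commute)
    qed
    have geo: "summable (\<lambda>j. G k * (1/4)^j)"
      by (intro summable_mult summable_geometric) simp
    have sum: "summable (\<lambda>j. c j * g k (x j))"
      by (rule summable_comparison_test'[OF geo]) (use summand in simp)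
    have geo': "summable (\<lambda>j. G k * (1/4)^(j + Suc k))"
      using summable_ignore_initial_segment[OF geo] .
    have "\<bar>\<Sum>j. c (j + Suc k) * g k (x (j + Suc k))\<bar> \<le> (\<Sum>j. G k * (1/4)^(j + Suc k))"
    proof -
      have *: "summable (\<lambda>j. norm (c (j + Suc k) * g k (x (j + Suc k))))"
        by (rule summable_comparison_test'[OF geo'])
          (unfold real_norm_def abs_idempotent, rule summand)
      have "norm (\<Sum>j. c (j + Suc k) * g k (x (j + Suc k)))
          \<le> (\<Sum>j. norm (c (j + Suc k) * g k (x (j + Suc k))))"
        by (rule summable_norm[OF *])
      also have "\<dots> \<le> (\<Sum>j. G k * (1/4)^(j + Suc k))"
        by (intro suminf_le * geo', unfold real_norm_def, rule summand)
      finally show ?thesis by simp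
    qed
    also have "(\<Sum>j. G k * (1/4)^(j + Suc k)) = G k * (1/4)^Suc k * (\<Sum>j. (1/4)^j)"
      by (subst suminf_mult[symmetric]) (auto simp: power_add mult_ac intro!: summable_geometric)
    also have "\<dots> = (1/4)^k * G k / 3"
      by (subst suminf_geometric) auto
    finally have tail: "\<bar>\<Sum>j. c (j + Suc k) * g k (x (j + Suc k))\<bar> \<le> (1/4)^k * G k / 3" .
    have "(\<Sum>j. c j * g k (x j)) = (\<Sum>j. c (j + Suc k) * g k (x (j + Suc k))) +
        ((\<Sum>j<k. c j * g k (x j)) + c k * g k (x k))"
      using suminf_split_initial_segment[OF sum, of "Suc k"] by simp
    moreover have "5/12 * ((1/4)^k * G k) \<le> \<bar>(\<Sum>j<k. c j * g k (x j)) + c k * g k (x k)\<bar>"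
      using c unfolding P_def by blast
    ultimately show ?thesis
      using tail by linarith
  qed
  with c01 show thesis by (rule that)
qed

text \<open>
  The measure \<open>\<Sum>\<^sub>j c j \<delta>\<^sub>x\<^sub>j\<close>, built as the image under \<open>x\<close> of the measure on the naturals with density \<open>c\<close>.
\<close>

lemma discrete_measure_integral:
  fixes x :: "nat \<Rightarrow> 'a::metric_space" and c :: "nat \<Rightarrow> real"
  assumes c: "\<And>j. 0 \<le> c j" "summable c"
  obtains \<mu> where "\<mu> \<in> ca"
    "\<And>f. signed_integral \<mu> (apply_ucb f) = (\<Sum>j. c j * apply_ucb f (x j))"
proof -
  define D where "D = density (count_space UNIV) (\<lambda>j. ennreal (c j))"
  define M where "M = distr D borel x"
  have x: "x \<in> D \<rightarrow>\<^sub>M borel" by (simp add: D_def)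
  have "emeasure D UNIV = (\<integral>\<^sup>+j. ennreal (c j) \<partial>count_space UNIV)"
    by (simp add: D_def emeasure_density)
  also have "\<dots> = (\<Sum>j. ennreal (c j))"
    by (rule nn_integral_count_space_nat)
  also have "\<dots> = ennreal (suminf c)"
    by (rule suminf_ennreal2[OF c])
  finally have "emeasure D (space D) \<noteq> \<infinity>" by (simp add: D_def)
  then have "finite_measure D" by (rule finite_measureI)
  then have M: "finite_measure M" "sets M = sets borel"
    unfolding M_def by (auto intro: finite_measure.finite_measure_distr x)
  have "signed_integral (measure M) (apply_ucb f) = (\<Sum>j. c j * apply_ucb f (x j))" for f
  proof -
    have "summable (\<lambda>j. norm (c j * apply_ucb f (x j)))"
      using c(1) abs_apply_ucb_le_norm[of f]
      by (intro summable_comparison_test'[OF summable_mult2[OF c(2), of "norm f"]])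
        (simp add: abs_mult mult_left_mono)
    then have "integrable (count_space UNIV) (\<lambda>j. c j * apply_ucb f (x j))"
      by (simp add: integrable_count_space_nat_iff)
    then have "(\<integral>j. c j * apply_ucb f (x j) \<partial>count_space UNIV) = (\<Sum>j. c j * apply_ucb f (x j))"
      by (rule integral_count_space_nat)
    moreover have "(\<integral>y. apply_ucb f y \<partial>M) = (\<integral>j. apply_ucb f (x j) \<partial>D)"
      unfolding M_def by (rule integral_distr[OF x]) simp
    moreover have "\<dots> = (\<integral>j. c j * apply_ucb f (x j) \<partial>count_space UNIV)"
      unfolding D_def by (subst integral_density) (auto simp: c)
    ultimately show ?thesis
      by (simp add: signed_integral_finite_borel_measure[OF M])
  qed
  with finite_borel_measure_ca[OF M] show thesis by (rule that)
qed

text \<open>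
  A uniform boundedness principle for the pairing with measures.  If the norms were unbounded,
  functions with norm beyond \<open>12 \<cdot> 4\<^sup>k \<cdot> (k + 1)\<close> could be selected, and the measure with gliding hump
  weights at their peaks would have integrals at least \<open>k + 1\<close> against them.
\<close>

lemma norm_bounded_if_signed_integrals_tend_to_zero:
  fixes h :: "nat \<Rightarrow> 'a::metric_space ucb"
  assumes "\<And>\<mu>. \<mu> \<in> ca \<Longrightarrow> (\<lambda>n. signed_integral \<mu> (apply_ucb (h n))) \<longlonglongrightarrow> 0"
  shows "bdd_above (range (\<lambda>n. norm (h n)))"
proof (rule ccontr)
  assume "\<not> ?thesis"
  then have "\<exists>n. C < norm (h n)" for C
    unfolding bdd_above_def by (metis not_le rangeE)
  then have "\<forall>k. \<exists>n. 12 * 4^k * (real k + 1) < norm (h n)" by blast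
  from choice[OF this] obtain n where n: "\<And>k. 12 * 4^k * (real k + 1) < norm (h (n k))"
    by blast
  have "\<exists>x. 5/6 * norm (h (n k)) \<le> \<bar>apply_ucb (h (n k)) x\<bar>" for k
  proof -
    have "h (n k) \<noteq> 0" 
    proof
      assume "h (n k) = 0"
      moreover have "0 \<le> 12 * 4^k * (real k + 1)" by simp
      then have "0 < norm (h (n k))" using n[of k] by (rule le_less_trans)
      ultimately show False by simp
    qed
    then show ?thesis
      using norm_ucb_attained_up_to[of "5/6" "h (n k)"] by auto
  qed
  then obtain x where x: "\<And>k. 5/6 * norm (h (n k)) \<le> \<bar>apply_ucb (h (n k)) (x k)\<bar>"
    by metis
  obtain c where c: "\<And>j. c j \<in> {0, (1/4)^j}"
      "\<And>k. (1/4)^k * norm (h (n k)) / 12 \<le> \<bar>\<Sum>j. c j * apply_ucb (h (n k)) (x j)\<bar>"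
    using gliding_hump_weights[of "\<lambda>k. apply_ucb (h (n k))" "\<lambda>k. norm (h (n k))" x]
      abs_apply_ucb_le_norm x by blast
  have c0: "0 \<le> c j" "c j \<le> (1/4)^j" for j
    using c(1)[of j] by auto
  then have "summable c"
    by (intro summable_comparison_test'[OF summable_geometric[of "1/4::real"]]) auto
  with c0 obtain \<mu> where \<mu>: "\<mu> \<in> ca"
      "\<And>f. signed_integral \<mu> (apply_ucb f) = (\<Sum>j. c j * apply_ucb f (x j))"
    using discrete_measure_integral[of c x] by blast
  have "Bseq (\<lambda>n. signed_integral \<mu> (apply_ucb (h n)))"
    by (rule convergent_imp_Bseq[OF convergentI[OF assms[OF \<mu>(1)]]])
  then obtain B where B: "\<And>n. \<bar>signed_integral \<mu> (apply_ucb (h n))\<bar> \<le> B"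
    unfolding Bseq_def by auto
  obtain k :: nat where k: "B < real k" using reals_Archimedean2 by blast
  have "real k + 1 = (1/4)^k * (12 * 4^k * (real k + 1)) / 12"
    by (simp add: power_one_over field_simps)
  also have "\<dots> \<le> (1/4)^k * norm (h (n k)) / 12"
    using n[of k] by (intro divide_right_mono mult_left_mono) auto
  also have "\<dots> \<le> B"
    using c(2)[of k] B[of "n k"] unfolding \<mu>(2) by linarith
  finally show False using k by simp
qed

text \<open>
  The measures enter in both directions: testing against them forces norm boundedness, and given
  norm boundedness and convergence on compact sets, in particular at points, dominated convergence
  returns the convergence of the integrals.
\<close>

lemma limitin_tauK_iff_K_convergent:
  "limitin tauK fs f sequentially \<longleftrightarrow> K_convergent fs f"
proof
  assume lim: "limitin tauK fs f sequentially"
  then have "bdd_above (range (\<lambda>n. norm (fs n - f)))"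
    by (intro norm_bounded_if_signed_integrals_tend_to_zero) (simp add: limitin_tauK)
  then obtain C where C: "\<And>n. norm (fs n - f) \<le> C"
    by (auto simp: bdd_above_def)
  have "norm (fs n) \<le> C + norm f" for n
    using C[of n] norm_triangle_sub[of "fs n" f] by linarith
  then have "bdd_above (range (\<lambda>n. norm (fs n)))"
    by (auto simp: bdd_above_def)
  with lim show "K_convergent fs f"
    by (simp add: limitin_tauK K_convergent_def)
next
  assume conv: "K_convergent fs f"
  then obtain C where C: "\<And>n. norm (fs n) \<le> C"
    by (auto simp: K_convergent_def bdd_above_def)
  have "norm (fs n - f) \<le> C + norm f" for n
    using C[of n] norm_triangle_ineq4[of "fs n" f] by linarith
  moreover have "(\<lambda>n. apply_ucb (fs n - f) x) \<longlonglongrightarrow> 0" for x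
    using conv by (intro tendsto_apply_ucb_zero) (simp add: K_convergent_def)
  ultimately have "(\<lambda>n. signed_integral \<mu> (apply_ucb (fs n - f))) \<longlonglongrightarrow> 0" if "\<mu> \<in> ca" for \<mu>
    by (intro signed_integral_dominated_convergence[OF that])
  with conv show "limitin tauK fs f sequentially"
    by (simp add: limitin_tauK K_convergent_def)
qed

section \<open>Selections along weakly continuous semigroups\<close>

lemma K_convergent_sup_on:
  "K_convergent fs f \<Longrightarrow> compact K \<Longrightarrow> K \<noteq> {} \<Longrightarrow> (\<lambda>n. sup_on K (fs n - f)) \<longlonglongrightarrow> 0"
  by (simp add: K_convergent_def)

lemma K_convergent_norm_bound:
  assumes "K_convergent fs f"
  obtains C where "0 \<le> C" "\<And>n. norm (fs n) \<le> C"
proof -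
  obtain C where "\<And>n. norm (fs n) \<le> C"
    using assms by (auto simp: K_convergent_def bdd_above_def)
  with order.trans[OF norm_ge_zero this] show thesis by (intro that)
qed

lemma K_convergentI:
  assumes "\<And>n. norm (fs n) \<le> C"
    and "\<And>K. compact K \<Longrightarrow> K \<noteq> {} \<Longrightarrow> (\<lambda>n. sup_on K (fs n - f)) \<longlonglongrightarrow> 0"
  shows "K_convergent fs f"
  using assms by (auto simp: K_convergent_def bdd_above_def)

lemma growth_boundD: "growth_bound T M \<alpha> \<Longrightarrow> 0 \<le> t \<Longrightarrow> norm (T t f) \<le> M * exp (\<alpha> * t) * norm f"
  by (simp add: growth_bound_def)

lemma growth_bound_on_interval:
  assumes "growth_bound T M \<alpha>" "0 \<le> M" "0 \<le> t" "t \<le> R"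
  shows "norm (T t f) \<le> M * exp (\<bar>\<alpha>\<bar> * R) * norm f"
proof -
  have "\<alpha> * t \<le> \<bar>\<alpha>\<bar> * R"
    using assms by (meson abs_ge_self abs_ge_zero mult_mono)
  then have "M * exp (\<alpha> * t) * norm f \<le> M * exp (\<bar>\<alpha>\<bar> * R) * norm f"
    using assms by (intro mult_right_mono mult_left_mono) auto
  with growth_boundD[OF assms(1,3)] show ?thesis by (rule order.trans)
qed

lemma weakly_continuous_linear: "weakly_continuous_semigroup T \<Longrightarrow> 0 \<le> t \<Longrightarrow> linear (T t)"
  by (simp add: weakly_continuous_semigroup_def bounded_linear.linear)

lemma weakly_continuous_semigroup_law: "weakly_continuous_semigroup T \<Longrightarrow> semigroup_law T"
  by (simp add: weakly_continuous_semigroup_def)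

lemma weakly_continuous_growth_bound:
  assumes "weakly_continuous_semigroup T"
  obtains M \<alpha> where "1 \<le> M" "growth_bound T M \<alpha>"
proof -
  have "\<exists>M\<ge>1. \<exists>\<alpha>. growth_bound T M \<alpha>"
    using assms by (simp only: weakly_continuous_semigroup_def)
  then show thesis using that by blast
qed

lemma weakly_continuous_SUP:
  assumes "weakly_continuous_semigroup T" "K_convergent fs f" "0 < R" "compact K" "K \<noteq> {}"
  shows "(\<lambda>n. SUP t\<in>{0..R}. sup_on K (T t (fs n) - T t f)) \<longlonglongrightarrow> 0"
  using assms by (simp add: weakly_continuous_semigroup_def)

lemma semigroup_law_add: "semigroup_law T \<Longrightarrow> 0 \<le> t \<Longrightarrow> 0 \<le> s \<Longrightarrow> T (t + s) f = T t (T s f)"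
  by (simp add: semigroup_law_def)

lemma K_convergent_selection:
  assumes T: "weakly_continuous_semigroup T" and conv: "K_convergent zs z"
    and ts: "\<And>n. 0 \<le> ts n" "\<And>n. ts n \<le> R"
  shows "K_convergent (\<lambda>n. T (ts n) (zs n) - T (ts n) z) 0"
proof -
  obtain M \<alpha> where M: "1 \<le> M" "growth_bound T M \<alpha>"
    using weakly_continuous_growth_bound[OF T] .
  obtain C where C: "0 \<le> C" "\<And>n. norm (zs n) \<le> C"
    using K_convergent_norm_bound[OF conv] by blast
  \<comment> \<open>The axiom on suprema concerns intervals of positive length.\<close>
  define R' where "R' = max R 1"
  have R': "0 < R'" "\<And>n. ts n \<in> {0..R'}"
    using ts by (auto simp: R'_def le_max_iff_disj)
  define B where "B = M * exp (\<bar>\<alpha>\<bar> * R') * C + M * exp (\<bar>\<alpha>\<bar> * R') * norm z"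
  have B: "norm (T t (zs n) - T t z) \<le> B" if t: "t \<in> {0..R'}" for t n
  proof -
    have "norm (T t (zs n)) \<le> M * exp (\<bar>\<alpha>\<bar> * R') * norm (zs n)"
      "norm (T t z) \<le> M * exp (\<bar>\<alpha>\<bar> * R') * norm z"
      using growth_bound_on_interval[OF M(2)] M(1) t by auto
    moreover have "M * exp (\<bar>\<alpha>\<bar> * R') * norm (zs n) \<le> M * exp (\<bar>\<alpha>\<bar> * R') * C"
      using M(1) C(2)[of n] by (intro mult_left_mono) auto
    ultimately show ?thesis
      unfolding B_def using norm_triangle_ineq4[of "T t (zs n)" "T t z"] by linarith
  qed
  show ?thesis
  proof (rule K_convergentI)
    show "norm (T (ts n) (zs n) - T (ts n) z) \<le> B" for n
      using B R'(2) by blast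
    fix K :: "'a set" assume K: "compact K" "K \<noteq> {}"
    have bdd: "bdd_above ((\<lambda>t. sup_on K (T t (zs n) - T t z)) ` {0..R'})" for n
      by (rule bdd_aboveI2[of _ _ B]) (rule order.trans[OF sup_on_le_norm[OF K(2)] B])
    have lim: "(\<lambda>n. SUP t\<in>{0..R'}. sup_on K (T t (zs n) - T t z)) \<longlonglongrightarrow> 0"
      by (rule weakly_continuous_SUP[OF T conv R'(1) K])
    show "(\<lambda>n. sup_on K (T (ts n) (zs n) - T (ts n) z - 0)) \<longlonglongrightarrow> 0"
    proof (rule Lim_null_comparison[OF _ lim], intro always_eventually allI)
      fix n
      show "norm (sup_on K (T (ts n) (zs n) - T (ts n) z - 0))
          \<le> (SUP t\<in>{0..R'}. sup_on K (T t (zs n) - T t z))"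
        unfolding diff_zero real_norm_def abs_of_nonneg[OF sup_on_nonneg[OF K(2)]]
        by (rule cSUP_upper[OF R'(2) bdd])
    qed
  qed
qed

text \<open>
  Up to a large time \<open>R\<close> the locally uniform statement applies, to the times cut off at \<open>R\<close>; beyond \<open>R\<close>
  the norm itself is small, uniformly in \<open>n\<close>, because a \<open>\<K>\<close>-convergent sequence is bounded.
\<close>

lemma K_convergent_selection_decaying:
  assumes T: "weakly_continuous_semigroup T" and M: "1 \<le> M" "growth_bound T M \<alpha>" and \<alpha>: "\<alpha> < 0"
    and conv: "K_convergent zs z" and ts: "\<And>n. 0 \<le> ts n"
  shows "K_convergent (\<lambda>n. T (ts n) (zs n) - T (ts n) z) 0"
proof -
  obtain C where C: "0 \<le> C" "\<And>n. norm (zs n) \<le> C"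
    using K_convergent_norm_bound[OF conv] by blast
  define B where "B = C + norm z"
  have decay: "norm (T t (zs n) - T t z) \<le> M * exp (\<alpha> * t) * B" if t: "0 \<le> t" for t n
  proof -
    have "norm (T t (zs n - z)) \<le> M * exp (\<alpha> * t) * norm (zs n - z)"
      by (rule growth_boundD[OF M(2) t])
    also have "\<dots> \<le> M * exp (\<alpha> * t) * B"
      using M(1) C(2)[of n] norm_triangle_ineq4[of "zs n" z]
      by (intro mult_left_mono) (auto simp: B_def)
    finally show ?thesis
      by (simp add: linear_diff[OF weakly_continuous_linear[OF T t]])
  qed
  have B: "0 \<le> B" using C by (simp add: B_def)
  show ?thesis
  proof (rule K_convergentI)
    show "norm (T (ts n) (zs n) - T (ts n) z) \<le> M * B" for n
    proof -
      have "M * exp (\<alpha> * ts n) * B \<le> M * 1 * B"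
        using M(1) B \<alpha> ts[of n]
        by (intro mult_right_mono mult_left_mono) (auto simp: mult_nonpos_nonneg)
      with decay[OF ts, of n n] show ?thesis by simp
    qed
    fix K :: "'a set" assume K: "compact K" "K \<noteq> {}"
    show "(\<lambda>n. sup_on K (T (ts n) (zs n) - T (ts n) z - 0)) \<longlonglongrightarrow> 0"
    proof (rule tendstoI)
      fix e :: real assume e: "e > 0"
      have "((\<lambda>R. M * exp (\<alpha> * R) * B) \<longlongrightarrow> M * 0 * B) at_top"
        using \<alpha> by (intro tendsto_intros filterlim_compose[OF exp_at_bot]
            filterlim_tendsto_neg_mult_at_bot[OF tendsto_const]) (auto simp: filterlim_ident)
      then have "eventually (\<lambda>R. M * exp (\<alpha> * R) * B < e) at_top"
        using e by (auto dest: order_tendstoD(2))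
      then obtain R where R: "\<And>t. R \<le> t \<Longrightarrow> M * exp (\<alpha> * t) * B < e"
        unfolding eventually_at_top_linorder by blast
      have "K_convergent (\<lambda>n. T (min (ts n) (max R 0)) (zs n) - T (min (ts n) (max R 0)) z) 0"
        using ts by (intro K_convergent_selection[OF T conv, where R="max R 0"]) auto
      from K_convergent_sup_on[OF this K]
      have "eventually (\<lambda>n. sup_on K (T (min (ts n) (max R 0)) (zs n) - T (min (ts n) (max R 0)) z) < e)
          sequentially"
        using e by (auto dest: order_tendstoD(2))
      then show "eventually (\<lambda>n. dist (sup_on K (T (ts n) (zs n) - T (ts n) z - 0)) 0 < e) sequentially"
      proof eventually_elim
        case (elim n)
        have "sup_on K (T (ts n) (zs n) - T (ts n) z) < e"
        proof (cases "ts n \<le> max R 0")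
          case True
          with elim show ?thesis by (simp add: min_absorb1)
        next
          case False
          then have "M * exp (\<alpha> * ts n) * B < e" by (intro R) auto
          with decay[OF ts, of n n] sup_on_le_norm[OF K(2), of "T (ts n) (zs n) - T (ts n) z"]
          show ?thesis by linarith
        qed
        then show ?case
          by (simp add: dist_real_def sup_on_nonneg[OF K(2)])
      qed
    qed
  qed
qed

lemma K_convergent_orbit:
  assumes T: "weakly_continuous_semigroup T" and ts: "\<And>n. 0 \<le> ts n" "ts \<longlonglongrightarrow> 0"
  shows "K_convergent (\<lambda>n. T (ts n) f) f"
proof -
  obtain M \<alpha> where M: "1 \<le> M" "growth_bound T M \<alpha>"
    using weakly_continuous_growth_bound[OF T] .
  obtain R where "\<And>n. \<bar>ts n\<bar> \<le> R"
    using convergent_imp_Bseq[OF convergentI[OF ts(2)]] unfolding Bseq_def by auto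
  then have R: "\<And>n. ts n \<le> R"
    using abs_le_D1 by blast
  show ?thesis
  proof (rule K_convergentI)
    show "norm (T (ts n) f) \<le> M * exp (\<bar>\<alpha>\<bar> * R) * norm f" for n
      using M ts(1) R by (intro growth_bound_on_interval) auto
    fix K :: "'a set" assume K: "compact K" "K \<noteq> {}"
    have T0: "T 0 f = f"
      using T by (simp add: weakly_continuous_semigroup_def semigroup_law_def)
    have "((\<lambda>t. sup_on K (T t f - f)) \<longlongrightarrow> 0) (at 0 within {0..})"
      using T K by (simp add: weakly_continuous_semigroup_def at_within_Ici_at_right)
    moreover have "sup_on K (T 0 f - f) = 0"
      using seminorm_zero[OF seminorm_sup_on[OF K(2)]] by (simp add: T0)
    ultimately have "continuous (at 0 within {0..}) (\<lambda>t. sup_on K (T t f - f))"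
      by (simp add: continuous_within)
    from continuous_within_tendsto_compose'[OF this _ ts(2)] ts(1)
    show "(\<lambda>n. sup_on K (T (ts n) f - f)) \<longlonglongrightarrow> 0"
      using \<open>sup_on K (T 0 f - f) = 0\<close> by simp
  qed
qed

text \<open>
  For \<open>s \<le> t\<close> the increment is \<open>T s (T (t - s) f - f)\<close>.  Since \<open>T h f\<close> is \<open>\<K>\<close>-convergent to \<open>f\<close> as \<open>h \<rightarrow> 0\<close>,
  it is small uniformly in \<open>s\<close>; this settles left and right continuity at once.
\<close>

lemma orbit_K_uniformly_continuous:
  assumes T: "weakly_continuous_semigroup T" and K: "compact K" "K \<noteq> {}" and e: "0 < e"
  shows "\<exists>d>0. \<forall>s\<in>{0..b}. \<forall>t\<in>{0..b}. \<bar>s - t\<bar> < d \<longrightarrow> sup_on K (T s f - T t f) < e"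
proof -
  have "\<exists>d>0. \<forall>s t. 0 \<le> s \<and> s \<le> t \<and> t \<le> b \<and> t - s < d \<longrightarrow> sup_on K (T t f - T s f) < e"
  proof (rule ccontr)
    assume "\<not> ?thesis"
    then have "\<exists>s t. 0 \<le> s \<and> s \<le> t \<and> t \<le> b \<and> t - s < 1 / (real n + 1) \<and>
        e \<le> sup_on K (T t f - T s f)" for n
      by (force simp: not_less dest: spec[of _ "1 / (real n + 1)"])
    then obtain s t where st: "\<And>n. 0 \<le> s n" "\<And>n. s n \<le> t n" "\<And>n. t n \<le> b"
        "\<And>n. t n - s n < 1 / (real n + 1)" "\<And>n. e \<le> sup_on K (T (t n) f - T (s n) f)"
      by metis
    have "(\<lambda>n. t n - s n) \<longlonglongrightarrow> 0"
    proof (rule Lim_null_comparison)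
      show "\<forall>\<^sub>F n in sequentially. norm (t n - s n) \<le> 1 / (real n + 1)"
        using st(2,4) by (simp add: less_imp_le)
      show "(\<lambda>n. 1 / (real n + 1)) \<longlonglongrightarrow> 0"
        using LIMSEQ_inverse_real_of_nat by (simp add: field_simps)
    qed
    then have "K_convergent (\<lambda>n. T (t n - s n) f) f"
      using st(2) by (intro K_convergent_orbit[OF T]) auto
    then have "K_convergent (\<lambda>n. T (s n) (T (t n - s n) f) - T (s n) f) 0"
      using st(1-3) by (intro K_convergent_selection[OF T, where R=b]) (auto intro: order.trans)
    moreover have "T (s n) (T (t n - s n) f) = T (t n) f" for n
      using T st(1,2)[of n] semigroup_law_add[of T "s n" "t n - s n" f]
      by (simp add: weakly_continuous_semigroup_def)
    ultimately have "K_convergent (\<lambda>n. T (t n) f - T (s n) f) 0" by simp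
    from K_convergent_sup_on[OF this K]
    have "eventually (\<lambda>n. sup_on K (T (t n) f - T (s n) f) < e) sequentially"
      using e by (auto dest: order_tendstoD(2))
    then show False using st(5) by (simp add: not_less[symmetric])
  qed
  then obtain d where d: "d > 0"
    "\<And>s t. 0 \<le> s \<Longrightarrow> s \<le> t \<Longrightarrow> t \<le> b \<Longrightarrow> t - s < d \<Longrightarrow> sup_on K (T t f - T s f) < e"
    by blast
  have "sup_on K (T s f - T t f) < e"
    if "s \<in> {0..b}" "t \<in> {0..b}" "\<bar>s - t\<bar> < d" for s t
    using that d(2)[of s t] d(2)[of t s] seminorm_minus[OF seminorm_sup_on[OF K(2)], of "T s f - T t f"]
    by (cases "s \<le> t") auto
  with d(1) show ?thesis by blast
qed

lemma limitin_tauK_orbit: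
  assumes T: "weakly_continuous_semigroup T"
  shows "limitin tauK (\<lambda>t. T t f) f (at_right 0)"
  unfolding limitin_tauK
proof (intro conjI allI impI ballI)
  fix K :: "'a set" assume "compact K \<and> K \<noteq> {}"
  then show "((\<lambda>t. sup_on K (T t f - f)) \<longlongrightarrow> 0) (at_right 0)"
    using T by (simp add: weakly_continuous_semigroup_def)
next
  fix \<mu> :: "'a set \<Rightarrow> real" assume \<mu>: "\<mu> \<in> ca"
  show "((\<lambda>t. signed_integral \<mu> (apply_ucb (T t f - f))) \<longlongrightarrow> 0) (at_right 0)"
    unfolding tendsto_at_iff_sequentially comp_def
  proof (intro allI impI)
    fix ts :: "nat \<Rightarrow> real" assume ts: "\<forall>i. ts i \<in> {0<..} - {0}" "ts \<longlonglongrightarrow> 0"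
    then have "K_convergent (\<lambda>n. T (ts n) f) f"
      by (intro K_convergent_orbit[OF T]) (auto simp: less_imp_le)
    with \<mu> show "(\<lambda>i. signed_integral \<mu> (apply_ucb (T (ts i) f - f))) \<longlonglongrightarrow> 0"
      by (simp add: limitin_tauK flip: limitin_tauK_iff_K_convergent)
  qed
qed

lemma C0_semigroup_weakly_continuous:
  "weakly_continuous_semigroup T \<Longrightarrow> C0_semigroup tauK T"
  by (simp add: C0_semigroup_def hausdorff_locally_convex_tauK weakly_continuous_linear
      limitin_tauK_orbit weakly_continuous_semigroup_law)

text \<open>
  Selecting at each stage an index with \<open>u n i \<ge> e / 2\<close>, if there is one, bounds all suprema from some
  stage on by \<open>e / 2\<close>.  This leads from selections back to the suprema in the definition of weak
  continuity.
\<close>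

lemma SUP_tendsto_zero_of_selections:
  fixes u :: "nat \<Rightarrow> 'i \<Rightarrow> real"
  assumes "I \<noteq> {}" and nonneg: "\<And>n i. i \<in> I \<Longrightarrow> 0 \<le> u n i"
    and sel: "\<And>i. (\<And>n. i n \<in> I) \<Longrightarrow> (\<lambda>n. u n (i n)) \<longlonglongrightarrow> 0"
  shows "(\<lambda>n. SUP i\<in>I. u n i) \<longlonglongrightarrow> 0"
proof (rule LIMSEQ_I)
  fix e :: real assume e: "0 < e"
  have "\<forall>n. \<exists>i. i \<in> I \<and> ((\<exists>j\<in>I. e / 2 \<le> u n j) \<longrightarrow> e / 2 \<le> u n i)"
    using \<open>I \<noteq> {}\<close> by blast
  from choice[OF this] obtain i
    where i: "\<And>n. i n \<in> I" "\<And>n. (\<exists>j\<in>I. e / 2 \<le> u n j) \<longrightarrow> e / 2 \<le> u n (i n)"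
    by blast
  have "eventually (\<lambda>n. u n (i n) < e / 2) sequentially"
    using e by (intro order_tendstoD(2)[OF sel[OF i(1)]]) simp
  then obtain N where N: "\<And>n. N \<le> n \<Longrightarrow> u n (i n) < e / 2"
    unfolding eventually_sequentially by blast
  have "norm ((SUP i\<in>I. u n i) - 0) < e" if "N \<le> n" for n
  proof -
    have small: "u n j \<le> e / 2" if "j \<in> I" for j
      using N[OF \<open>N \<le> n\<close>] i(2)[of n] that by (meson linorder_not_le less_imp_le)
    then have "(SUP i\<in>I. u n i) \<le> e / 2"
      by (intro cSUP_least \<open>I \<noteq> {}\<close>)
    moreover have "u n (i n) \<le> (SUP i\<in>I. u n i)"
      using small by (intro cSUP_upper i(1) bdd_aboveI2)
    ultimately show ?thesis
      using nonneg[OF i(1), of n n] e by simp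
  qed
  then show "\<exists>N. \<forall>n\<ge>N. norm ((SUP i\<in>I. u n i) - 0) < e" by blast
qed

lemma seq_equicontinuous_tauKI:
  assumes "\<And>zs z i. K_convergent zs z \<Longrightarrow> (\<And>n. i n \<in> I) \<Longrightarrow>
      K_convergent (\<lambda>n. f (i n) (zs n) - f (i n) z) 0"
  shows "seq_equicontinuous tauK I f"
  using assms unfolding seq_equicontinuous_iff_selections[OF topspace_tauK]
    limitin_tauK_iff_K_convergent by blast

lemma C0_seq_locally_equicontinuous_weakly_continuous:
  assumes T: "weakly_continuous_semigroup T"
  shows "C0_seq_locally_equicontinuous_semigroup tauK T"
  unfolding C0_seq_locally_equicontinuous_semigroup_def
proof (intro conjI allI impI C0_semigroup_weakly_continuous[OF T])
  fix R :: real
  show "seq_equicontinuous tauK {0..R} T"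
    by (rule seq_equicontinuous_tauKI) (rule K_convergent_selection[OF T, where R=R], auto)
qed

lemma C0_seq_equicontinuous_decaying:
  assumes T: "weakly_continuous_semigroup T" and M: "1 \<le> M" "growth_bound T M \<alpha>" and \<alpha>: "\<alpha> < 0"
  shows "C0_seq_equicontinuous_semigroup tauK T"
  unfolding C0_seq_equicontinuous_semigroup_def
proof (intro conjI C0_semigroup_weakly_continuous[OF T])
  show "seq_equicontinuous tauK {0..} T"
    by (rule seq_equicontinuous_tauKI) (rule K_convergent_selection_decaying[OF T M \<alpha>], auto)
qed

section \<open>Exponential rescaling\<close>

lemma growth_bound_rescaled:
  assumes "growth_bound T M \<alpha>"
  shows "growth_bound (\<lambda>t f. exp (- (l * t)) *\<^sub>R T t f) M (\<alpha> - l)"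
  unfolding growth_bound_def
proof (intro allI impI)
  fix t :: real and f assume "0 \<le> t"
  then have "exp (- (l * t)) * norm (T t f) \<le> exp (- (l * t)) * (M * exp (\<alpha> * t) * norm f)"
    by (intro mult_left_mono growth_boundD[OF assms]) auto
  also have "\<dots> = M * exp ((\<alpha> - l) * t) * norm f"
    by (simp add: left_diff_distrib exp_diff exp_minus field_simps)
  finally show "norm (exp (- (l * t)) *\<^sub>R T t f) \<le> M * exp ((\<alpha> - l) * t) * norm f" by simp
qed

lemma exp_rescaling_le:
  fixes l t R :: real
  assumes "0 \<le> t" "t \<le> R"
  shows "exp (- (l * t)) \<le> exp (\<bar>l\<bar> * R)"
proof -
  have "- (l * t) \<le> \<bar>l\<bar> * t"
    using assms(1) mult_right_mono[OF abs_ge_minus_self[of l], of t] by simp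
  also have "\<dots> \<le> \<bar>l\<bar> * R"
    using assms(2) by (intro mult_left_mono) auto
  finally show ?thesis by simp
qed

text \<open>
  Rescaling shifts the growth exponent, so that everything about \<open>e\<^sup>-\<^sup>\<lambda>\<^sup>t T t\<close> reduces to weakly
  continuous semigroups with negative growth exponent.
\<close>

lemma weakly_continuous_rescaled:
  fixes T :: "real \<Rightarrow> 'a::metric_space ucb \<Rightarrow> 'a ucb"
  assumes T: "weakly_continuous_semigroup T"
  shows "weakly_continuous_semigroup (\<lambda>t f. exp (- (l * t)) *\<^sub>R T t f)"
  unfolding weakly_continuous_semigroup_def
proof (intro conjI allI impI)
  show "bounded_linear (\<lambda>f. exp (- (l * t)) *\<^sub>R T t f)" if "0 \<le> t" for t
    using T that by (simp add: weakly_continuous_semigroup_def bounded_linear_const_scaleR)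
  note law = weakly_continuous_semigroup_law[OF T]
  show "semigroup_law (\<lambda>t f. exp (- (l * t)) *\<^sub>R T t f)"
    unfolding semigroup_law_def
  proof (intro conjI allI impI)
    show "(\<lambda>f. exp (- (l * 0)) *\<^sub>R T 0 f) = id"
      using law by (simp add: semigroup_law_def id_def)
    fix t s :: real assume ts: "0 \<le> t" "0 \<le> s"
    show "(\<lambda>f. exp (- (l * (t + s))) *\<^sub>R T (t + s) f) =
        (\<lambda>f. exp (- (l * t)) *\<^sub>R T t f) \<circ> (\<lambda>f. exp (- (l * s)) *\<^sub>R T s f)"
      using semigroup_law_add[OF law ts]
      by (auto simp: linear_scale[OF weakly_continuous_linear[OF T ts(1)]] distrib_left
          simp flip: exp_add)
  qed
  obtain M \<alpha> where M: "1 \<le> M" "growth_bound T M \<alpha>"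
    using weakly_continuous_growth_bound[OF T] .
  then show "\<exists>M\<ge>1. \<exists>\<alpha>. growth_bound (\<lambda>t f. exp (- (l * t)) *\<^sub>R T t f) M \<alpha>"
    using growth_bound_rescaled by blast
  show "locally_equi_uniformly_continuous (\<lambda>t f. exp (- (l * t)) *\<^sub>R T t f)"
    unfolding locally_equi_uniformly_continuous_def
  proof (intro allI impI)
    fix f and R :: real assume R: "0 < R"
    have "locally_equi_uniformly_continuous T"
      using T by (simp add: weakly_continuous_semigroup_def)
    with R obtain w where w: "modulus_of_continuity w" "\<And>\<xi> \<xi>' t. t \<in> {0..R} \<Longrightarrow>
        \<bar>apply_ucb (T t f) \<xi> - apply_ucb (T t f) \<xi>'\<bar> \<le> w (dist \<xi> \<xi>')"
      unfolding locally_equi_uniformly_continuous_def by blast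
    have "modulus_of_continuity (\<lambda>r. exp (\<bar>l\<bar> * R) * w r)"
      using w(1) unfolding modulus_of_continuity_def
      by (auto simp: mono_on_def tendsto_mult_right_zero)
    moreover have "\<bar>apply_ucb (exp (- (l * t)) *\<^sub>R T t f) \<xi> - apply_ucb (exp (- (l * t)) *\<^sub>R T t f) \<xi>'\<bar>
        \<le> exp (\<bar>l\<bar> * R) * w (dist \<xi> \<xi>')" if "t \<in> {0..R}" for t \<xi> \<xi>'
    proof -
      have "exp (- (l * t)) * \<bar>apply_ucb (T t f) \<xi> - apply_ucb (T t f) \<xi>'\<bar>
          \<le> exp (\<bar>l\<bar> * R) * w (dist \<xi> \<xi>')"
        using that by (intro mult_mono w(2) exp_rescaling_le) auto
      then show ?thesis by (simp add: abs_mult flip: right_diff_distrib)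
    qed
    ultimately show "\<exists>w. modulus_of_continuity w \<and> (\<forall>\<xi> \<xi>'. \<forall>t\<in>{0..R}.
        \<bar>apply_ucb (exp (- (l * t)) *\<^sub>R T t f) \<xi> - apply_ucb (exp (- (l * t)) *\<^sub>R T t f) \<xi>'\<bar>
        \<le> w (dist \<xi> \<xi>'))" by blast
  qed
next
  fix f and K :: "'a set" assume K: "compact K \<and> K \<noteq> {}"
  have "((\<lambda>t. exp (- (l * t)) * sup_on K (T t f - f) + \<bar>exp (- (l * t)) - 1\<bar> * sup_on K f)
      \<longlongrightarrow> exp (- (l * 0)) * 0 + \<bar>exp (- (l * 0)) - 1\<bar> * sup_on K f) (at_right 0)"
    using T K by (intro tendsto_intros) (simp add: weakly_continuous_semigroup_def)
  then have lim: "((\<lambda>t. exp (- (l * t)) * sup_on K (T t f - f) + \<bar>exp (- (l * t)) - 1\<bar> * sup_on K f)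
      \<longlongrightarrow> 0) (at_right 0)" by simp
  show "((\<lambda>t. sup_on K (exp (- (l * t)) *\<^sub>R T t f - f)) \<longlongrightarrow> 0) (at_right 0)"
  proof (rule Lim_null_comparison[OF _ lim], intro always_eventually allI)
    fix t
    have "sup_on K (exp (- (l * t)) *\<^sub>R (T t f - f) + (exp (- (l * t)) - 1) *\<^sub>R f)
        \<le> exp (- (l * t)) * sup_on K (T t f - f) + \<bar>exp (- (l * t)) - 1\<bar> * sup_on K f"
      using sup_on_triangle[of K "exp (- (l * t)) *\<^sub>R (T t f - f)" "(exp (- (l * t)) - 1) *\<^sub>R f"] K
      by (simp add: sup_on_scaleR)
    moreover have "exp (- (l * t)) *\<^sub>R (T t f - f) + (exp (- (l * t)) - 1) *\<^sub>R f =
        exp (- (l * t)) *\<^sub>R T t f - f" by (simp add: algebra_simps)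
    ultimately show "norm (sup_on K (exp (- (l * t)) *\<^sub>R T t f - f))
        \<le> exp (- (l * t)) * sup_on K (T t f - f) + \<bar>exp (- (l * t)) - 1\<bar> * sup_on K f"
      using K by (simp add: sup_on_nonneg)
  qed
next
  fix fs :: "nat \<Rightarrow> 'a ucb" and f and R :: real and K :: "'a set"
  assume conv: "K_convergent fs f" and R: "0 < R" and K: "compact K \<and> K \<noteq> {}"
  show "(\<lambda>n. SUP t\<in>{0..R}. sup_on K (exp (- (l * t)) *\<^sub>R T t (fs n) - exp (- (l * t)) *\<^sub>R T t f)) \<longlonglongrightarrow> 0"
  proof (rule SUP_tendsto_zero_of_selections)
    fix ts :: "nat \<Rightarrow> real" assume ts: "\<And>n. ts n \<in> {0..R}"
    then have "K_convergent (\<lambda>n. T (ts n) (fs n) - T (ts n) f) 0"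
      by (intro K_convergent_selection[OF T conv, where R=R]) auto
    from K_convergent_sup_on[OF this] K
    have lim: "(\<lambda>n. exp (\<bar>l\<bar> * R) * sup_on K (T (ts n) (fs n) - T (ts n) f)) \<longlonglongrightarrow> 0"
      by (intro tendsto_mult_right_zero) simp
    show "(\<lambda>n. sup_on K (exp (- (l * ts n)) *\<^sub>R T (ts n) (fs n) - exp (- (l * ts n)) *\<^sub>R T (ts n) f)) \<longlonglongrightarrow> 0"
    proof (rule Lim_null_comparison[OF _ lim], intro always_eventually allI)
      fix n
      have "exp (- (l * ts n)) * sup_on K (T (ts n) (fs n) - T (ts n) f)
          \<le> exp (\<bar>l\<bar> * R) * sup_on K (T (ts n) (fs n) - T (ts n) f)"
        using ts[of n] K by (intro mult_right_mono exp_rescaling_le) (auto simp: sup_on_nonneg)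
      then show "norm (sup_on K (exp (- (l * ts n)) *\<^sub>R T (ts n) (fs n) - exp (- (l * ts n)) *\<^sub>R T (ts n) f))
          \<le> exp (\<bar>l\<bar> * R) * sup_on K (T (ts n) (fs n) - T (ts n) f)"
        using K by (simp add: sup_on_scaleR sup_on_nonneg flip: scaleR_diff_right)
    qed
  qed (use R K in \<open>auto simp: sup_on_nonneg\<close>)
qed

section \<open>Riemann integrals of orbits\<close>

lemma apply_ucb_sum: "apply_ucb (sum f A) x = (\<Sum>a\<in>A. apply_ucb (f a) x)"
  by (induction A rule: infinite_finite_induct) simp_all

lemma integral_riemann_sum_error:
  fixes f :: "real \<Rightarrow> real"
  assumes p: "p tagged_division_of {a..b}" and "a \<le> b" and f: "continuous_on {a..b} f"
    and mesh: "\<And>t k. (t, k) \<in> p \<Longrightarrow> measure lborel k < d"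
    and osc: "\<And>s t. s \<in> {a..b} \<Longrightarrow> t \<in> {a..b} \<Longrightarrow> \<bar>s - t\<bar> < d \<Longrightarrow> \<bar>f s - f t\<bar> \<le> e"
  shows "\<bar>(\<Sum>(t, k)\<in>p. measure lborel k * f t) - integral {a..b} f\<bar> \<le> e * (b - a)"
proof -
  have "integral {a..b} f = (\<Sum>(t, k)\<in>p. integral k f)"
    using integral_combine_tagged_division_topdown[of f a b p] p f
    by (simp add: integrable_continuous_interval)
  then have "\<bar>(\<Sum>(t, k)\<in>p. measure lborel k * f t) - integral {a..b} f\<bar> =
      \<bar>\<Sum>(t, k)\<in>p. measure lborel k * f t - integral k f\<bar>"
    by (simp add: sum_subtractf case_prod_beta)
  also have "\<dots> \<le> (\<Sum>(t, k)\<in>p. \<bar>measure lborel k * f t - integral k f\<bar>)"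
    by (simp add: case_prod_beta sum_abs)
  also have "\<dots> \<le> (\<Sum>(t, k)\<in>p. e * measure lborel k)"
  proof (rule sum_mono, clarify)
    fix t k assume tk: "(t, k) \<in> p"
    obtain u v where k: "k = {u..v}" using tagged_division_ofD(4)[OF p tk] by auto
    have t: "t \<in> k" and sub: "k \<subseteq> {a..b}"
      using tagged_division_ofD(2,3)[OF p tk] by auto
    then have uv: "u \<le> v" and vu: "v - u < d"
      using k mesh[OF tk] by auto
    have int: "f integrable_on k"
      using continuous_on_subset[OF f sub] unfolding k by (rule integrable_continuous_interval)
    have "((\<lambda>s. f t - f s) has_integral (measure lborel k * f t - integral k f)) {u..v}"
      using has_integral_diff[OF has_integral_const_real[of "f t" u v] integrable_integral[OF int, unfolded k]]
      by (simp add: k)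
    moreover have "0 \<le> e"
      using osc[of t t] t sub vu uv by auto
    moreover have "\<bar>f t - f s\<bar> \<le> e" if "s \<in> {u..v}" for s
      using that t sub vu unfolding k by (intro osc) auto
    ultimately have "norm (measure lborel k * f t - integral k f) \<le> e * measure lborel {u..v}"
      by (intro has_integral_bound_real[where f="\<lambda>s. f t - f s"]) auto
    then show "\<bar>measure lborel k * f t - integral k f\<bar> \<le> e * measure lborel k"
      by (simp add: k)
  qed
  also have "\<dots> = e * (\<Sum>(t, k)\<in>p. measure lborel k)"
    by (simp add: sum_distrib_left case_prod_beta)
  also have "(\<Sum>(t, k)\<in>p. measure lborel k) = b - a"
    using additive_content_tagged_division[of p a b] p \<open>a \<le> b\<close> by simp
  finally show ?thesis .
qed

lemma continuous_on_apply_ucb: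
  fixes g :: "real \<Rightarrow> 'a::metric_space ucb"
  assumes "\<And>e. 0 < e \<Longrightarrow> \<exists>d>0. \<forall>s\<in>S. \<forall>t\<in>S. \<bar>s - t\<bar> < d \<longrightarrow> sup_on {x} (g s - g t) < e"
  shows "continuous_on S (\<lambda>t. apply_ucb (g t) x)"
  unfolding continuous_on_iff
proof (intro ballI allI impI)
  fix t e :: real assume t: "t \<in> S" and e: "0 < e"
  obtain d where d: "d > 0" "\<And>s. s \<in> S \<Longrightarrow> \<bar>s - t\<bar> < d \<Longrightarrow> sup_on {x} (g s - g t) < e"
    using assms[OF e] t by blast
  have "dist (apply_ucb (g s) x) (apply_ucb (g t) x) < e" if "s \<in> S" "dist s t < d" for s
    using d(2)[of s] that abs_apply_ucb_le_sup_on[of x "{x}" "g s - g t"]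
    by (simp add: dist_real_def)
  with d(1) show "\<exists>d>0. \<forall>s\<in>S. dist s t < d \<longrightarrow>
      dist (apply_ucb (g s) x) (apply_ucb (g t) x) < e" by blast
qed

text \<open>
  The integral is taken pointwise in \<open>x\<close>, and \<open>equi\<close> makes the result uniformly continuous.  Riemann
  sums over partitions whose mesh tends to \<open>0\<close> are norm bounded and converge uniformly on compact
  sets, hence they are \<open>\<K>\<close>-convergent, and for sequences this is convergence in the topology.  It
  suffices to look at sequences, because a neighbourhood missed by arbitrarily fine partitions is
  missed by a sequence of partitions with mesh below \<open>1 / (n + 1)\<close>.
\<close>

lemma has_riemann_integral_tauK:
  fixes g :: "real \<Rightarrow> 'a::metric_space ucb"
  assumes "a \<le> b" and bound: "\<And>t. t \<in> {a..b} \<Longrightarrow> norm (g t) \<le> C"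
    and cont: "\<And>K e. compact K \<Longrightarrow> K \<noteq> {} \<Longrightarrow> 0 < e \<Longrightarrow>
      \<exists>d>0. \<forall>s\<in>{a..b}. \<forall>t\<in>{a..b}. \<bar>s - t\<bar> < d \<longrightarrow> sup_on K (g s - g t) < e"
    and equi: "\<And>e. 0 < e \<Longrightarrow> \<exists>d>0. \<forall>t\<in>{a..b}. \<forall>x y. dist x y < d \<longrightarrow>
      \<bar>apply_ucb (g t) x - apply_ucb (g t) y\<bar> < e"
  obtains J where "\<And>x. apply_ucb J x = integral {a..b} (\<lambda>t. apply_ucb (g t) x)"
    "has_riemann_integral tauK g a b J"
proof -
  have cont_x: "continuous_on {a..b} (\<lambda>t. apply_ucb (g t) x)" for x
    by (rule continuous_on_apply_ucb) (rule cont, auto)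
  define h where "h x = integral {a..b} (\<lambda>t. apply_ucb (g t) x)" for x
  have "\<bar>h x\<bar> \<le> C * (b - a)" for x
    using integral_bound[OF \<open>a \<le> b\<close> cont_x, of x C] order.trans[OF abs_apply_ucb_le_norm bound]
    by (simp add: h_def)
  then have "bounded (range h)"
    by (auto simp: bounded_iff)
  moreover have "uniformly_continuous_on UNIV h"
    unfolding uniformly_continuous_on_def
  proof (intro allI impI)
    fix e :: real assume e: "0 < e"
    define e' where "e' = e / (b - a + 1)"
    have e': "0 < e'" "e' * (b - a) < e"
      using e \<open>a \<le> b\<close> by (auto simp: e'_def field_simps)
    obtain d where d: "d > 0" "\<And>t x y. t \<in> {a..b} \<Longrightarrow> dist x y < d \<Longrightarrow>
        \<bar>apply_ucb (g t) x - apply_ucb (g t) y\<bar> < e'"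
      using equi[OF e'(1)] by blast
    have "dist (h y) (h x) < e" if "dist y x < d" for x y
    proof -
      have "h y - h x = integral {a..b} (\<lambda>t. apply_ucb (g t) y - apply_ucb (g t) x)"
        unfolding h_def by (intro integral_diff[symmetric] integrable_continuous_interval cont_x)
      also have "norm \<dots> \<le> e' * (b - a)"
        using d(2)[OF _ that] by (intro integral_bound \<open>a \<le> b\<close> continuous_intros cont_x)
          (auto simp: less_imp_le)
      finally show ?thesis using e'(2) by (simp add: dist_norm)
    qed
    with d(1) show "\<exists>d>0. \<forall>x\<in>UNIV. \<forall>x'\<in>UNIV. dist x' x < d \<longrightarrow> dist (h x') (h x) < e" by blast
  qed
  ultimately obtain J where J: "apply_ucb J = h"
    by (rule obtain_ucb)
  define R where "R p = (\<Sum>(t, k)\<in>p. measure lborel k *\<^sub>R g t)" for p :: "(real \<times> real set) set"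
  have "has_riemann_integral tauK g a b J"
    unfolding has_riemann_integral_def
  proof (intro allI impI)
    fix U assume U: "openin tauK U \<and> J \<in> U"
    show "\<exists>\<delta>>0. \<forall>p. p tagged_division_of {a..b} \<and> (\<forall>(t, k)\<in>p. measure lborel k < \<delta>) \<longrightarrow>
        (\<Sum>(t, k)\<in>p. measure lborel k *\<^sub>R g t) \<in> U"
    proof (rule ccontr)
      assume neg: "\<not> ?thesis"
      have "\<forall>n. \<exists>p. p tagged_division_of {a..b} \<and> (\<forall>(t, k)\<in>p. measure lborel k < 1 / (real n + 1)) \<and> R p \<notin> U"
      proof
        fix n
        have "0 < 1 / (real n + 1)" by simp
        with neg show "\<exists>p. p tagged_division_of {a..b} \<and>
            (\<forall>(t, k)\<in>p. measure lborel k < 1 / (real n + 1)) \<and> R p \<notin> U"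
          unfolding R_def by blast
      qed
      from choice[OF this] obtain p where p: "\<And>n. p n tagged_division_of {a..b}"
          "\<And>n t k. (t, k) \<in> p n \<Longrightarrow> measure lborel k < 1 / (real n + 1)" "\<And>n. R (p n) \<notin> U"
        by blast
      have "K_convergent (\<lambda>n. R (p n)) J"
      proof (rule K_convergentI)
        show "norm (R (p n)) \<le> C * (b - a)" for n
        proof -
          have "norm (R (p n)) \<le> (\<Sum>(t, k)\<in>p n. C * measure lborel k)"
            unfolding R_def
          proof (rule sum_norm_le, clarify)
            fix t k assume tk: "(t, k) \<in> p n"
            have "t \<in> {a..b}" using tagged_division_ofD(2,3)[OF p(1) tk] by blast
            from mult_right_mono[OF bound[OF this], of "measure lborel k"]
            show "norm (measure lborel k *\<^sub>R g t) \<le> C * measure lborel k"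
              by (simp add: mult.commute)
          qed
          also have "\<dots> = C * (\<Sum>(t, k)\<in>p n. measure lborel k)"
            by (simp add: sum_distrib_left case_prod_beta)
          also have "(\<Sum>(t, k)\<in>p n. measure lborel k) = b - a"
            using additive_content_tagged_division[of "p n" a b] p(1) \<open>a \<le> b\<close> by simp
          finally show ?thesis .
        qed
        fix K :: "'a set" assume K: "compact K" "K \<noteq> {}"
        show "(\<lambda>n. sup_on K (R (p n) - J)) \<longlonglongrightarrow> 0"
        proof (rule LIMSEQ_I)
          fix e :: real assume e: "0 < e"
          define e' where "e' = e / (b - a + 1)"
          have e': "0 < e'" "e' * (b - a) < e"
            using e \<open>a \<le> b\<close> by (auto simp: e'_def field_simps)
          obtain d where d: "d > 0" "\<And>s t. s \<in> {a..b} \<Longrightarrow> t \<in> {a..b} \<Longrightarrow> \<bar>s - t\<bar> < d \<Longrightarrow>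
              sup_on K (g s - g t) < e'"
            using cont[OF K e'(1)] by blast
          obtain N :: nat where N: "1 / (real N + 1) < d"
            using reals_Archimedean[OF d(1)] by (auto simp: field_simps)
          have "norm (sup_on K (R (p n) - J) - 0) < e" if n: "N \<le> n" for n
          proof -
            have "1 / (real n + 1) \<le> 1 / (real N + 1)"
              using n by (simp add: frac_le)
            then have mesh: "measure lborel k < d" if "(t, k) \<in> p n" for t k
              using p(2)[OF that] N by linarith
            have "\<bar>apply_ucb (R (p n) - J) x\<bar> \<le> e' * (b - a)" if "x \<in> K" for x
            proof -
              have osc: "\<bar>apply_ucb (g s) x - apply_ucb (g t) x\<bar> \<le> e'"
                if "s \<in> {a..b}" "t \<in> {a..b}" "\<bar>s - t\<bar> < d" for s t
                using d(2)[OF that] abs_apply_ucb_le_sup_on[OF \<open>x \<in> K\<close>, of "g s - g t"] by simp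
              have "\<bar>(\<Sum>(t, k)\<in>p n. measure lborel k * apply_ucb (g t) x) -
                  integral {a..b} (\<lambda>t. apply_ucb (g t) x)\<bar> \<le> e' * (b - a)"
                by (rule integral_riemann_sum_error[OF p(1) \<open>a \<le> b\<close> cont_x mesh osc])
              then show ?thesis
                by (simp add: J h_def R_def apply_ucb_sum case_prod_beta)
            qed
            from sup_on_leI[OF K(2) this] show ?thesis
              using e'(2) sup_on_nonneg[OF K(2)] by simp
          qed
          then show "\<exists>N. \<forall>n\<ge>N. norm (sup_on K (R (p n) - J) - 0) < e" by blast
        qed
      qed
      then have "limitin tauK (\<lambda>n. R (p n)) J sequentially"
        by (simp add: limitin_tauK_iff_K_convergent)
      then have "eventually (\<lambda>n. R (p n) \<in> U) sequentially"
        using U by (simp add: limitin_def)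
      then show False using p(3) by simp
    qed
  qed
  then show thesis
    by (rule that[rotated]) (simp add: J h_def)
qed

lemma ucb_uniform_limit:
  fixes h :: "'a::metric_space \<Rightarrow> real"
  assumes "\<And>e. 0 < e \<Longrightarrow> \<exists>f. \<forall>x. \<bar>apply_ucb f x - h x\<bar> \<le> e"
  obtains f where "apply_ucb f = h"
proof (rule obtain_ucb)
  obtain f where f: "\<And>x. \<bar>apply_ucb f x - h x\<bar> \<le> 1"
    using assms[of 1] by auto
  have "\<bar>h x\<bar> \<le> norm f + 1" for x
    using f[of x] abs_apply_ucb_le_norm[of f x] by linarith
  then show "bounded (range h)" by (auto simp: bounded_iff)
  show "uniformly_continuous_on UNIV h"
    unfolding uniformly_continuous_on_def
  proof (intro allI impI)
    fix e :: real assume e: "0 < e"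
    then obtain f where f: "\<And>x. \<bar>apply_ucb f x - h x\<bar> \<le> e / 3"
      using assms[of "e / 3"] by auto
    obtain d where d: "d > 0" "\<And>x y. dist y x < d \<Longrightarrow> dist (apply_ucb f y) (apply_ucb f x) < e / 3"
      using uniformly_continuous_apply_ucb[of f] e unfolding uniformly_continuous_on_def
      by (metis UNIV_I divide_pos_pos zero_less_numeral)
    have "dist (h y) (h x) < e" if "dist y x < d" for x y
      using d(2)[OF that] f[of x] f[of y] unfolding dist_real_def by linarith
    with d(1) show "\<exists>d>0. \<forall>x\<in>UNIV. \<forall>x'\<in>UNIV. dist x' x < d \<longrightarrow> dist (h x') (h x) < e" by blast
  qed
qed (rule that)

lemma modulus_of_continuity_small:
  assumes "modulus_of_continuity w" "0 < e"
  obtains d where "0 < d" "\<And>r. 0 \<le> r \<Longrightarrow> r < d \<Longrightarrow> w r < e"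
proof -
  have w: "w 0 = 0" "(w \<longlongrightarrow> 0) (at_right 0)"
    using assms(1) by (auto simp: modulus_of_continuity_def)
  have "eventually (\<lambda>r. w r < e) (at_right 0)"
    using order_tendstoD(2)[OF w(2) assms(2)] .
  then obtain d where "0 < d" "\<And>r. 0 < r \<Longrightarrow> r < d \<Longrightarrow> w r < e"
    by (auto simp: eventually_at_right_field)
  with w(1) assms(2) show thesis
    by (intro that[of d]) (auto simp: le_less)
qed

lemma orbit_riemann_integral:
  fixes T :: "real \<Rightarrow> 'a::metric_space ucb \<Rightarrow> 'a ucb"
  assumes T: "weakly_continuous_semigroup T" and "0 \<le> a"
  obtains J where "\<And>x. apply_ucb J x = integral {0..a} (\<lambda>t. apply_ucb (T t f) x)"
    "has_riemann_integral tauK (\<lambda>t. T t f) 0 a J"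
proof -
  obtain M \<alpha> where M: "1 \<le> M" "growth_bound T M \<alpha>"
    using weakly_continuous_growth_bound[OF T] .
  show thesis
  proof (rule has_riemann_integral_tauK[of 0 a "\<lambda>t. T t f"])
    show "norm (T t f) \<le> M * exp (\<bar>\<alpha>\<bar> * a) * norm f" if "t \<in> {0..a}" for t
      using that M by (intro growth_bound_on_interval) auto
    show "\<exists>d>0. \<forall>s\<in>{0..a}. \<forall>t\<in>{0..a}. \<bar>s - t\<bar> < d \<longrightarrow> sup_on K (T s f - T t f) < e"
      if "compact K" "K \<noteq> {}" "0 < e" for K e
      using orbit_K_uniformly_continuous[OF T that, of a f] .
    fix e :: real assume e: "0 < e"
    have "locally_equi_uniformly_continuous T"
      using T by (simp add: weakly_continuous_semigroup_def)
    moreover have "0 < a + 1" using \<open>0 \<le> a\<close> by simp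
    ultimately obtain w where w: "modulus_of_continuity w" "\<And>\<xi> \<xi>' t. t \<in> {0..a + 1} \<Longrightarrow>
        \<bar>apply_ucb (T t f) \<xi> - apply_ucb (T t f) \<xi>'\<bar> \<le> w (dist \<xi> \<xi>')"
      unfolding locally_equi_uniformly_continuous_def by blast
    obtain d where d: "0 < d" "\<And>r. 0 \<le> r \<Longrightarrow> r < d \<Longrightarrow> w r < e"
      using modulus_of_continuity_small[OF w(1) e] by blast
    have "\<bar>apply_ucb (T t f) x - apply_ucb (T t f) y\<bar> < e" if "t \<in> {0..a}" "dist x y < d" for t x y
      using w(2)[of t x y] d(2)[of "dist x y"] that by auto
    with d(1) show "\<exists>d>0. \<forall>t\<in>{0..a}. \<forall>x y. dist x y < d \<longrightarrow>
        \<bar>apply_ucb (T t f) x - apply_ucb (T t f) y\<bar> < e" by blast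
  qed (use \<open>0 \<le> a\<close> that in auto)
qed

text \<open>
  The integrals over \<open>[0, a]\<close> differ from each other in norm by at most \<open>E a\<close>, the integral of the growth
  bound over the tail \<open>[a, \<infinity>)\<close>.  Hence they converge in norm, and a fortiori in the topology.
\<close>

lemma generalized_riemann_integrable_decaying:
  fixes T :: "real \<Rightarrow> 'a::metric_space ucb \<Rightarrow> 'a ucb"
  assumes T: "weakly_continuous_semigroup T" and M: "1 \<le> M" "growth_bound T M \<alpha>" and \<alpha>: "\<alpha> < 0"
  shows "generalized_riemann_integrable tauK (\<lambda>t. T t f)"
proof -
  have "\<forall>a. \<exists>J. 0 \<le> a \<longrightarrow> (\<forall>x. apply_ucb J x = integral {0..a} (\<lambda>t. apply_ucb (T t f) x)) \<and>
      has_riemann_integral tauK (\<lambda>t. T t f) 0 a J"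
    using orbit_riemann_integral[OF T] by metis
  from choice[OF this] obtain J
    where J: "\<And>a x. 0 \<le> a \<Longrightarrow> apply_ucb (J a) x = integral {0..a} (\<lambda>t. apply_ucb (T t f) x)"
      and J': "\<And>a. 0 \<le> a \<Longrightarrow> has_riemann_integral tauK (\<lambda>t. T t f) 0 a (J a)"
    by blast
  define E where "E a = M * norm f * exp (\<alpha> * a) / (- \<alpha>)" for a
  have E: "(E \<longlongrightarrow> 0) at_top"
  proof -
    have "((\<lambda>a. M * norm f * exp (\<alpha> * a) / (- \<alpha>)) \<longlongrightarrow> M * norm f * 0 / (- \<alpha>)) at_top"
      using \<alpha> by (intro tendsto_intros filterlim_compose[OF exp_at_bot]
          filterlim_tendsto_neg_mult_at_bot[OF tendsto_const]) (auto simp: filterlim_ident)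
    then show ?thesis by (simp add: E_def[abs_def])
  qed
  have diff: "\<bar>apply_ucb (J b) x - apply_ucb (J a) x\<bar> \<le> E a" if ab: "0 \<le> a" "a \<le> b" for a b x
  proof -
    have int: "(\<lambda>t. apply_ucb (T t f) x) integrable_on {0..b}"
      by (intro integrable_continuous_interval continuous_on_apply_ucb
          orbit_K_uniformly_continuous[OF T]) auto
    have int': "(\<lambda>t. apply_ucb (T t f) x) integrable_on {a..b}"
      using int by (rule integrable_on_subinterval) (use ab in auto)
    have "apply_ucb (J a) x + integral {a..b} (\<lambda>t. apply_ucb (T t f) x) = apply_ucb (J b) x"
      using Henstock_Kurzweil_Integration.integral_combine[OF ab int] ab by (simp add: J)
    moreover have "\<bar>integral {a..b} (\<lambda>t. apply_ucb (T t f) x)\<bar> \<le> E a"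
    proof -
      have exp_int: "((\<lambda>t. M * exp (\<alpha> * t) * norm f) has_integral
          (M * norm f * exp (\<alpha> * b) / \<alpha> - M * norm f * exp (\<alpha> * a) / \<alpha>)) {a..b}"
        using \<alpha> by (intro fundamental_theorem_of_calculus ab)
          (auto intro!: derivative_eq_intros simp flip: has_real_derivative_iff_has_vector_derivative)
      moreover have "norm (integral {a..b} (\<lambda>t. apply_ucb (T t f) x)) \<le>
          integral {a..b} (\<lambda>t. M * exp (\<alpha> * t) * norm f)"
        using exp_int ab order.trans[OF abs_apply_ucb_le_norm growth_boundD[OF M(2)]]
        by (intro integral_norm_bound_integral int') (auto simp: integrable_on_def)
      moreover have "M * norm f * exp (\<alpha> * b) / \<alpha> \<le> 0"
        using M(1) \<alpha> by (intro divide_nonneg_nonpos) auto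
      ultimately show ?thesis
        unfolding integral_unique[OF exp_int] E_def by simp
    qed
    ultimately show ?thesis by linarith
  qed
  define h where "h x = lim (\<lambda>n. apply_ucb (J (real n)) x)" for x
  have h: "(\<lambda>n. apply_ucb (J (real n)) x) \<longlonglongrightarrow> h x" for x
  proof -
    have "Cauchy (\<lambda>n. apply_ucb (J (real n)) x)"
    proof (rule metric_CauchyI)
      fix e :: real assume e: "0 < e"
      have "eventually (\<lambda>n. E (real n) < e / 2) sequentially"
        using e by (intro order_tendstoD(2)[OF filterlim_compose[OF E filterlim_real_sequentially]]) simp
      then obtain N where N: "E (real N) < e / 2"
        unfolding eventually_sequentially by blast
      have "dist (apply_ucb (J (real m)) x) (apply_ucb (J (real n)) x) < e" if "m \<ge> N" "n \<ge> N" for m n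
        using diff[of "real N" "real m" x] diff[of "real N" "real n" x] that N
        by (simp add: dist_real_def)
      then show "\<exists>N. \<forall>m\<ge>N. \<forall>n\<ge>N. dist (apply_ucb (J (real m)) x) (apply_ucb (J (real n)) x) < e"
        by blast
    qed
    then show ?thesis
      unfolding h_def by (simp add: Cauchy_convergent_iff convergent_LIMSEQ_iff)
  qed
  have tail: "\<bar>apply_ucb (J a) x - h x\<bar> \<le> E a" if a: "0 \<le> a" for a x
  proof (rule tendsto_upperbound)
    show "(\<lambda>n. \<bar>apply_ucb (J a) x - apply_ucb (J (real n)) x\<bar>) \<longlonglongrightarrow> \<bar>apply_ucb (J a) x - h x\<bar>"
      by (intro tendsto_intros h)
    have "eventually (\<lambda>n. a \<le> real n) sequentially"
      using filterlim_real_sequentially by (simp add: filterlim_at_top)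
    then show "eventually (\<lambda>n. \<bar>apply_ucb (J a) x - apply_ucb (J (real n)) x\<bar> \<le> E a) sequentially"
    proof eventually_elim
      case (elim n)
      then show ?case using diff[OF a elim, of x] by (simp add: abs_minus_commute)
    qed
  qed simp
  have "\<exists>f. \<forall>x. \<bar>apply_ucb f x - h x\<bar> \<le> e" if e: "0 < e" for e
  proof -
    have "eventually (\<lambda>a. E a < e \<and> 0 \<le> a) at_top"
      using order_tendstoD(2)[OF E e] eventually_ge_at_top by (rule eventually_conj)
    then obtain a where a: "E a < e" "0 \<le> a"
      by (auto simp: eventually_at_top_linorder)
    then have "\<bar>apply_ucb (J a) x - h x\<bar> \<le> e" for x
      using tail[of a x] by simp
    then show ?thesis by blast
  qed
  then obtain L where L: "apply_ucb L = h"
    using ucb_uniform_limit by blast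
  have "limitin tauK J L at_top"
  proof (rule limitin_tauK_of_norm, rule Lim_null_comparison[OF _ E])
    show "\<forall>\<^sub>F a in at_top. norm (norm (J a - L)) \<le> E a"
      using eventually_ge_at_top[of 0]
    proof eventually_elim
      case (elim a)
      then show ?case using tail[OF elim] by (auto intro!: norm_ucb_leI simp: L)
    qed
  qed
  with J' show ?thesis
    unfolding generalized_riemann_integrable_def by blast
qed

section \<open>Growth bounds from sequential equicontinuity\<close>

lemma C0_seq_locally_equicontinuous_selection:
  assumes T: "C0_seq_locally_equicontinuous_semigroup tauK T" and R: "0 < R"
    and conv: "K_convergent zs z" and ts: "\<And>n. ts n \<in> {0..R}"
  shows "K_convergent (\<lambda>n. T (ts n) (zs n) - T (ts n) z) 0"
proof -
  have "seq_equicontinuous tauK {0..R} T"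
    using T R by (simp add: C0_seq_locally_equicontinuous_semigroup_def)
  with conv ts show ?thesis
    unfolding seq_equicontinuous_iff_selections[OF topspace_tauK] limitin_tauK_iff_K_convergent
    by blast
qed

text \<open>
  If \<open>\<parallel>T (t n) (f n)\<parallel> > (n + 1)\<^sup>2 \<parallel>f n\<parallel>\<close>, then scaling \<open>f n\<close> to norm \<open>1 / (n + 1)\<close> gives a sequence that tends
  to \<open>0\<close>, although its images are unbounded in norm and so cannot converge in the topology.
\<close>

lemma C0_seq_locally_equicontinuous_bounded:
  fixes T :: "real \<Rightarrow> 'a::metric_space ucb \<Rightarrow> 'a ucb"
  assumes T: "C0_seq_locally_equicontinuous_semigroup tauK T" and R: "0 < R"
  obtains C where "\<And>t f. t \<in> {0..R} \<Longrightarrow> norm (T t f) \<le> C * norm f"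
proof (rule ccontr)
  assume neg: "\<not> thesis"
  have lin: "linear (T t)" if "0 \<le> t" for t
    using T that by (simp add: C0_seq_locally_equicontinuous_semigroup_def C0_semigroup_def)
  have "\<forall>n. \<exists>u. fst u \<in> {0..R} \<and> (real n + 1)\<^sup>2 * norm (snd u) < norm (T (fst u) (snd u))"
    using neg that by (metis fst_conv snd_conv not_le)
  from choice[OF this] obtain u where u: "\<And>n. fst (u n) \<in> {0..R}"
      "\<And>n. (real n + 1)\<^sup>2 * norm (snd (u n)) < norm (T (fst (u n)) (snd (u n)))"
    by blast
  define t where "t n = fst (u n)" for n
  define f where "f n = snd (u n)" for n
  have t: "t n \<in> {0..R}" and f: "(real n + 1)\<^sup>2 * norm (f n) < norm (T (t n) (f n))" for n
    using u by (auto simp: t_def f_def)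
  have f0: "f n \<noteq> 0" for n
    using f[of n] linear_0[OF lin, of "t n"] t[of n] by auto
  define zs where "zs n = (1 / ((real n + 1) * norm (f n))) *\<^sub>R f n" for n
  have norm_zs: "norm (zs n) = 1 / (real n + 1)" for n
    using f0 by (simp add: zs_def)
  have "(\<lambda>n. 1 / (real n + 1)) \<longlonglongrightarrow> 0"
    using LIMSEQ_inverse_real_of_nat by (simp add: field_simps)
  then have "limitin tauK zs 0 sequentially"
    by (intro limitin_tauK_of_norm) (simp add: norm_zs)
  then have "K_convergent zs 0"
    by (simp add: limitin_tauK_iff_K_convergent)
  from C0_seq_locally_equicontinuous_selection[OF T R this t]
  have bounded: "K_convergent (\<lambda>n. T (t n) (zs n) - T (t n) 0) 0" .
  obtain B where B: "0 \<le> B" "\<And>n. norm (T (t n) (zs n) - T (t n) 0) \<le> B"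
    using K_convergent_norm_bound[OF bounded] by blast
  have large: "real n + 1 \<le> B" for n
  proof -
    have "T (t n) (zs n) - T (t n) 0 = (1 / ((real n + 1) * norm (f n))) *\<^sub>R T (t n) (f n)"
      using lin[of "t n"] t[of n] by (simp add: zs_def linear_scale linear_0)
    then have "norm (T (t n) (f n)) / ((real n + 1) * norm (f n)) \<le> B"
      using B(2)[of n] by simp
    moreover have "real n + 1 \<le> norm (T (t n) (f n)) / ((real n + 1) * norm (f n))"
      using f[of n] f0[of n] by (simp add: pos_le_divide_eq power2_eq_square mult.assoc)
    ultimately show ?thesis by simp
  qed
  obtain n :: nat where "B < real n" using reals_Archimedean2 by blast
  with large[of n] show False by simp
qed

text \<open>
  A time below \<open>n + 1\<close> is covered by \<open>n + 1\<close> steps of length at most \<open>1\<close>, each of which costs a factor \<open>M\<close>.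
\<close>

lemma semigroup_growth_bound:
  fixes T :: "real \<Rightarrow> 'z::real_normed_vector \<Rightarrow> 'z"
  assumes law: "semigroup_law T" and M: "1 \<le> M"
    and unit: "\<And>t f. t \<in> {0..1} \<Longrightarrow> norm (T t f) \<le> M * norm f"
  shows "growth_bound T M (ln M)"
  unfolding growth_bound_def
proof (intro allI impI)
  have steps: "norm (T t f) \<le> M ^ Suc n * norm f" if "0 \<le> t" "t \<le> real n + 1" for t f n
    using that
  proof (induction n arbitrary: t)
    case 0
    then show ?case using unit[of t f] by simp
  next
    case (Suc n)
    show ?case
    proof (cases "t \<le> 1")
      case True
      have "norm (T t f) \<le> M * norm f" using unit Suc.prems True by simp
      also have "\<dots> \<le> M ^ Suc (Suc n) * norm f"
        using M power_increasing[of 1 "Suc (Suc n)" M] by (intro mult_right_mono) auto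
      finally show ?thesis .
    next
      case False
      then have "T t f = T 1 (T (t - 1) f)"
        using semigroup_law_add[OF law, of 1 "t - 1" f] by simp
      also have "norm \<dots> \<le> M * norm (T (t - 1) f)" by (rule unit) simp
      also have "\<dots> \<le> M * (M ^ Suc n * norm f)"
        using Suc False M by (intro mult_left_mono Suc.IH) auto
      finally show ?thesis by (simp add: mult.assoc)
    qed
  qed
  fix t :: real and f assume t: "0 \<le> t"
  have "norm (T t f) \<le> M ^ Suc (nat \<lfloor>t\<rfloor>) * norm f"
    using t by (intro steps) linarith+
  also have "M ^ Suc (nat \<lfloor>t\<rfloor>) = M * exp (ln M * real (nat \<lfloor>t\<rfloor>))"
    using M by (simp add: exp_of_nat2_mult)
  also have "\<dots> * norm f \<le> M * exp (ln M * t) * norm f"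
    using M t by (intro mult_right_mono mult_left_mono iffD2[OF exp_le_cancel_iff]) auto
  finally show "norm (T t f) \<le> M * exp (ln M * t) * norm f" .
qed

lemma weakly_continuous_of_C0_seq_locally_equicontinuous:
  fixes T :: "real \<Rightarrow> 'a::metric_space ucb \<Rightarrow> 'a ucb"
  assumes T: "C0_seq_locally_equicontinuous_semigroup tauK T"
    and equi: "locally_equi_uniformly_continuous T"
  shows "weakly_continuous_semigroup T"
  unfolding weakly_continuous_semigroup_def
proof (intro conjI)
  have lin: "linear (T t)" if "0 \<le> t" for t
    using T that by (simp add: C0_seq_locally_equicontinuous_semigroup_def C0_semigroup_def)
  show law: "semigroup_law T"
    using T by (simp add: C0_seq_locally_equicontinuous_semigroup_def C0_semigroup_def)
  obtain C where C: "\<And>t f. t \<in> {0..1} \<Longrightarrow> norm (T t f) \<le> C * norm f"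
    using C0_seq_locally_equicontinuous_bounded[OF T zero_less_one] by blast
  define M where "M = max C 1"
  have "norm (T t f) \<le> M * norm f" if "t \<in> {0..1}" for t f
    using C[OF that, of f] mult_right_mono[of C M "norm f"] by (simp add: M_def)
  then have growth: "growth_bound T M (ln M)"
    by (intro semigroup_growth_bound law) (simp add: M_def)
  then show "\<exists>M\<ge>1. \<exists>\<alpha>. growth_bound T M \<alpha>"
    by (intro exI[of _ M]) (auto simp: M_def)
  show "\<forall>t\<ge>0. bounded_linear (T t)"
  proof (intro allI impI)
    fix t :: real assume t: "0 \<le> t"
    then have "norm (T t f) \<le> norm f * (M * exp (ln M * t))" for f
      using growth_boundD[OF growth t, of f] by (simp add: mult.commute)
    then show "bounded_linear (T t)"
      using lin[OF t] unfolding linear_iff by (intro bounded_linear_intro) auto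
  qed
  show "locally_equi_uniformly_continuous T" by (rule equi)
  show "\<forall>f K. compact K \<and> K \<noteq> {} \<longrightarrow> ((\<lambda>t. sup_on K (T t f - f)) \<longlongrightarrow> 0) (at_right 0)"
    using T
    by (simp add: C0_seq_locally_equicontinuous_semigroup_def C0_semigroup_def limitin_tauK)
  show "\<forall>fs f. K_convergent fs f \<longrightarrow> (\<forall>R>0. \<forall>K. compact K \<and> K \<noteq> {} \<longrightarrow>
      (\<lambda>n. SUP t\<in>{0..R}. sup_on K (T t (fs n) - T t f)) \<longlonglongrightarrow> 0)"
  proof (intro allI impI)
    fix fs :: "nat \<Rightarrow> 'a ucb" and f and R :: real and K :: "'a set"
    assume conv: "K_convergent fs f" and R: "0 < R" and K: "compact K \<and> K \<noteq> {}"
    show "(\<lambda>n. SUP t\<in>{0..R}. sup_on K (T t (fs n) - T t f)) \<longlonglongrightarrow> 0"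
    proof (rule SUP_tendsto_zero_of_selections)
      fix ts :: "nat \<Rightarrow> real" assume "\<And>n. ts n \<in> {0..R}"
      then have "K_convergent (\<lambda>n. T (ts n) (fs n) - T (ts n) f) 0"
        by (rule C0_seq_locally_equicontinuous_selection[OF T R conv])
      from K_convergent_sup_on[OF this] K
      show "(\<lambda>n. sup_on K (T (ts n) (fs n) - T (ts n) f)) \<longlonglongrightarrow> 0" by simp
    qed (use R K in \<open>auto simp: sup_on_nonneg\<close>)
  qed
qed

theorem proposition4p19:
  fixes T :: "real \<Rightarrow> 'a::banach ucb \<Rightarrow> 'a ucb"
  shows "(weakly_continuous_semigroup T \<longrightarrow>
            C0_seq_locally_equicontinuous_semigroup tauK T \<and>
            (\<forall>\<alpha>. (\<exists>M\<ge>1. growth_bound T M \<alpha>) \<longrightarrow>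
              (\<forall>lam>\<alpha>.
                C0_seq_equicontinuous_semigroup tauK (\<lambda>t f. exp (- (lam * t)) *\<^sub>R T t f) \<and>
                (\<forall>f. \<forall>\<mu>>0. generalized_riemann_integrable tauK
                   (\<lambda>t. exp (- (\<mu> * t)) *\<^sub>R exp (- (lam * t)) *\<^sub>R T t f))))) \<and>
         (C0_seq_locally_equicontinuous_semigroup tauK T \<and>
            locally_equi_uniformly_continuous T \<longrightarrow>
          weakly_continuous_semigroup T)"
proof (intro conjI impI allI)
  assume T: "weakly_continuous_semigroup T"
  show "C0_seq_locally_equicontinuous_semigroup tauK T"
    by (rule C0_seq_locally_equicontinuous_weakly_continuous[OF T])
  fix \<alpha> lam :: real
  assume "\<exists>M\<ge>1. growth_bound T M \<alpha>" and lam: "\<alpha> < lam"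
  then obtain M where M: "1 \<le> M" "growth_bound T M \<alpha>" by blast
  let ?S = "\<lambda>t f. exp (- (lam * t)) *\<^sub>R T t f"
  have S: "weakly_continuous_semigroup ?S" "growth_bound ?S M (\<alpha> - lam)"
    by (rule weakly_continuous_rescaled[OF T], rule growth_bound_rescaled[OF M(2)])
  show "C0_seq_equicontinuous_semigroup tauK ?S"
    by (rule C0_seq_equicontinuous_decaying[OF S(1) M(1) S(2)]) (use lam in simp)
  fix f and \<mu> :: real assume "0 < \<mu>"
  with lam have "\<alpha> - lam - \<mu> < 0" by simp
  from generalized_riemann_integrable_decaying[OF weakly_continuous_rescaled[OF S(1)] M(1)
      growth_bound_rescaled[OF S(2)] this]
  show "generalized_riemann_integrable tauK
      (\<lambda>t. exp (- (\<mu> * t)) *\<^sub>R exp (- (lam * t)) *\<^sub>R T t f)" .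
next
  assume "C0_seq_locally_equicontinuous_semigroup tauK T \<and> locally_equi_uniformly_continuous T"
  then show "weakly_continuous_semigroup T"
    using weakly_continuous_of_C0_seq_locally_equicontinuous by blast
qed

end
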